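(* Let $A$ be a finite set and let $\mathbb{P}$ be a probability measure on $A^{\mathbb{N}}$, with coupling matrix $D^\sigma=(D^\sigma_{i,j})_{i,j\in\mathbb{N}}$. For $p\in\mathbb{N}$ let $\mathcal{D}^{(2p)}$ be the (non-random) matrix $\mathcal{D}^{(2p)}_{i,j}:=\mathbb{E}[(D^\sigma_{i,j})^{2p}]^{1/2p}$. Let $n\in\mathbb{N}$ be arbitrary. Then for all functions $g:A^n\to\mathbb{R}$ and any $p\in\mathbb{N}$, $$\mathbb{E}\left[(g-\mathbb{E}g)^{2p}\right]\leq(20p)^{2p}\,\|\mathcal{D}^{(2p)}\|^{2p}_{\ell^2(\mathbb{N})}\,\|\delta g\|^{2p}_{\ell^2(\mathbb{N})}.$$
   Context: $\mathbb{N}=\{1,2,\dots\}$. A function $g:A^n\to\mathbb{R}$ is also viewed as a function on $A^{\mathbb{N}}$ depending only on $\sigma_1,\dots,\sigma_n$; $\mathbb{E}$ is expectation with respect to $\mathbb{P}$. For a matrix $M$, $\|M\|_{\ell^2(\mathbb{N})}\in[0,\infty]$ is its operator norm on $\ell^2(\mathbb{N})$ (if it is infinite the right-hand side is $+\infty$ unless $\delta g=0$, in which case it is $0$). Variation: $\delta_i g:=\sup\{|g(\sigma)-g(\sigma')|:\sigma_j=\sigma'_j\ \forall j\neq i\}$; $\delta g=(\delta_jg)_{j\in\mathbb{N}}$ (so $\delta_jg=0$ for $j>n$). Coupling matrix: fix versions of the conditional distributions of the future coordinates given finitely many past ones. For $\sigma\in A^{\mathbb{N}}$, $i\in\mathbb{N}$,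 $a,b\in A$, let $\mathbb{P}^{\sigma}_{i,a,b}$ (depending on $\sigma$ only through $\sigma_1,\dots,\sigma_{i-1}$) be the maximal coupling of $\mathbb{P}(d\eta_{\geq i+1}\mid\sigma_1,\dots,\sigma_{i-1},\sigma_i=a)$ and $\mathbb{P}(d\eta_{\geq i+1}\mid\sigma_1,\dots,\sigma_{i-1},\sigma_i=b)$, i.e. a (fixed choice of) joint law of a pair $(\sigma^{(1)}_{\ge i+1},\sigma^{(2)}_{\ge i+1})$ with these two marginals for which the probability that the two components coincide is as large as possible. Then $D^\sigma$ is the upper-triangular matrix with $D^\sigma_{ii}:=1$, $D^\sigma_{i,i+j}:=\max_{a,b\in A}\mathbb{P}^{\sigma}_{i,a,b}\{\sigma^{(1)}_{i+j}\neq\sigma^{(2)}_{i+j}\}$ for $j\geq1$, and $D^\sigma_{i,k}=0$ for $k<i$. *)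

theory Defs
  imports "HOL-Probability.Probability"
begin

text \<open>
  Indices are the positive natural numbers \<open>{1..}\<close>. A family of letters indexed by \<open>I\<close> is an element of
  \<open>I \<rightarrow>\<^sub>E UNIV\<close> (undefined outside \<open>I\<close>), so that equality of two such functions is equality on \<open>I\<close>.
\<close>

definition seq_space :: "nat set \<Rightarrow> (nat \<Rightarrow> 'a::finite) measure" where
  "seq_space I = PiM I (\<lambda>_. count_space UNIV)"

text \<open>A function on \<open>A\<^sup>n\<close>, viewed as a function on the space of all sequences.\<close>

definition cylinder_fun :: "nat \<Rightarrow> ((nat \<Rightarrow> 'a::finite) \<Rightarrow> real) \<Rightarrow> (nat \<Rightarrow> 'a) \<Rightarrow> real" where
  "cylinder_fun n g \<sigma> = g (restrict \<sigma> {1..n})"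

text \<open>
  The supremum is taken in the reals; for a function of finitely many coordinates
  the set is finite and contains 0.
\<close>

definition variation :: "((nat \<Rightarrow> 'a::finite) \<Rightarrow> real) \<Rightarrow> nat \<Rightarrow> real" where
  "variation f i = Sup {\<bar>f \<sigma> - f \<sigma>'\<bar> | \<sigma> \<sigma>'.
     \<sigma> \<in> space (seq_space {1..}) \<and> \<sigma>' \<in> space (seq_space {1..}) \<and> (\<forall>j. j \<noteq> i \<longrightarrow> \<sigma> j = \<sigma>' j)}"

text \<open>
  \<open>K i x\<close> is the law of the coordinates \<open>\<ge> i + 1\<close> given that the first \<open>i\<close> coordinates are \<open>x\<close>.
  A version is free to be any probability measure when that event has probability 0.
\<close>

definition conditional_versions ::
  "(nat \<Rightarrow> 'a::finite) measure \<Rightarrow> (nat \<Rightarrow> (nat \<Rightarrow> 'a) \<Rightarrow> (nat \<Rightarrow> 'a) measure) \<Rightarrow> bool" where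
  "conditional_versions P K \<longleftrightarrow>
     (\<forall>i\<ge>1. \<forall>x \<in> {1..i} \<rightarrow>\<^sub>E UNIV.
        prob_space (K i x) \<and> sets (K i x) = sets (seq_space {i+1..}) \<and>
        (measure P {\<eta> \<in> space P. restrict \<eta> {1..i} = x} > 0 \<longrightarrow>
          (\<forall>B \<in> sets (seq_space {i+1..}).
             measure (K i x) B =
               cond_prob P (\<lambda>\<eta>. restrict \<eta> {i+1..} \<in> B) (\<lambda>\<eta>. restrict \<eta> {1..i} = x))))"

definition is_coupling :: "'b measure \<Rightarrow> 'b measure \<Rightarrow> ('b \<times> 'b) measure \<Rightarrow> bool" where
  "is_coupling \<mu> \<nu> Q \<longleftrightarrow>
     prob_space Q \<and> sets Q = sets (\<mu> \<Otimes>\<^sub>M \<nu>) \<and> distr Q \<mu> fst = \<mu> \<and> distr Q \<nu> snd = \<nu>"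

definition is_maximal_coupling :: "'b measure \<Rightarrow> 'b measure \<Rightarrow> ('b \<times> 'b) measure \<Rightarrow> bool" where
  "is_maximal_coupling \<mu> \<nu> Q \<longleftrightarrow>
     is_coupling \<mu> \<nu> Q \<and>
     (\<forall>Q'. is_coupling \<mu> \<nu> Q' \<longrightarrow>
        measure Q' {\<omega> \<in> space Q'. fst \<omega> = snd \<omega>} \<le> measure Q {\<omega> \<in> space Q. fst \<omega> = snd \<omega>})"

text \<open>
  \<open>Q i x a b\<close> is the chosen maximal coupling at position \<open>i\<close> for the letters \<open>a\<close>, \<open>b\<close>, where
  \<open>x\<close> is the past at positions \<open>1, \<dots>, i - 1\<close>.
\<close>

definition maximal_couplings ::
  "(nat \<Rightarrow> (nat \<Rightarrow> 'a::finite) \<Rightarrow> (nat \<Rightarrow> 'a) measure) \<Rightarrow>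
   (nat \<Rightarrow> (nat \<Rightarrow> 'a) \<Rightarrow> 'a \<Rightarrow> 'a \<Rightarrow> ((nat \<Rightarrow> 'a) \<times> (nat \<Rightarrow> 'a)) measure) \<Rightarrow> bool" where
  "maximal_couplings K Q \<longleftrightarrow>
     (\<forall>i\<ge>1. \<forall>x \<in> {1..<i} \<rightarrow>\<^sub>E UNIV. \<forall>a b.
        is_maximal_coupling (K i (x(i := a))) (K i (x(i := b))) (Q i x a b))"

definition coupling_matrix ::
  "(nat \<Rightarrow> (nat \<Rightarrow> 'a::finite) \<Rightarrow> 'a \<Rightarrow> 'a \<Rightarrow> ((nat \<Rightarrow> 'a) \<times> (nat \<Rightarrow> 'a)) measure) \<Rightarrow>
   (nat \<Rightarrow> 'a) \<Rightarrow> nat \<Rightarrow> nat \<Rightarrow> real" where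
  "coupling_matrix Q \<sigma> i k =
     (if k = i then 1
      else if i < k then
        Max (range (\<lambda>(a, b).
          let R = Q i (restrict \<sigma> {1..<i}) a b
          in measure R {\<omega> \<in> space R. fst \<omega> k \<noteq> snd \<omega> k}))
      else 0)"

definition moment_matrix ::
  "(nat \<Rightarrow> 'a) measure \<Rightarrow> ((nat \<Rightarrow> 'a) \<Rightarrow> nat \<Rightarrow> nat \<Rightarrow> real) \<Rightarrow> nat \<Rightarrow> nat \<Rightarrow> nat \<Rightarrow> real" where
  "moment_matrix P D q i j = (\<integral>\<sigma>. (D \<sigma> i j) ^ q \<partial>P) powr (1 / real q)"

definition in_l2 :: "(nat \<Rightarrow> real) \<Rightarrow> bool" where
  "in_l2 x \<longleftrightarrow> (\<lambda>i. (x i)\<^sup>2) summable_on {1..}"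

definition l2_norm :: "(nat \<Rightarrow> real) \<Rightarrow> real" where
  "l2_norm x = sqrt (\<Sum>\<^sub>\<infinity>i\<in>{1..}. (x i)\<^sup>2)"

definition mat_vec :: "(nat \<Rightarrow> nat \<Rightarrow> real) \<Rightarrow> (nat \<Rightarrow> real) \<Rightarrow> nat \<Rightarrow> real" where
  "mat_vec M x i = (\<Sum>\<^sub>\<infinity>j\<in>{1..}. M i j * x j)"

text \<open>
  The infimum of the empty set is \<open>\<infinity>\<close>, so the norm is \<open>\<infinity>\<close> exactly when the
  matrix does not define a bounded operator on the square summable sequences.
\<close>

definition l2_op_norm :: "(nat \<Rightarrow> nat \<Rightarrow> real) \<Rightarrow> ennreal" where
  "l2_op_norm M = Inf {ennreal C | C. 0 \<le> C \<and>
     (\<forall>x. in_l2 x \<longrightarrow>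
        (\<forall>i\<ge>1. (\<lambda>j. M i j * x j) summable_on {1..}) \<and>
        in_l2 (mat_vec M x) \<and> l2_norm (mat_vec M x) \<le> C * l2_norm x)}"

end

theory Submission
  imports Defs
begin

text \<open>
  Write \<open>g - E g\<close> as a sum of martingale differences \<open>V\<^sub>i\<close>. Averaging over the maximal coupling
  gives \<open>\<bar>V\<^sub>i\<bar> \<le> (D\<^sup>\<sigma> \<delta>g)\<^sub>i\<close> almost surely, and Minkowski's inequality in \<open>L\<^sup>2\<^sup>p\<close> turns this into
  \<open>\<parallel>V\<^sub>i\<parallel> \<le> (\<D>\<^sup>(\<^sup>2\<^sup>p\<^sup>) \<delta>g)\<^sub>i\<close>. In place of Burkholder's inequality it suffices to use the pointwise estimate
  \<open>(s + v)\<^sup>2\<^sup>p - 2p s\<^sup>2\<^sup>p\<^sup>-\<^sup>1 v \<le> (s\<^sup>2 + 4p v\<^sup>2)\<^sup>p\<close>: the linear term vanishes in expectation, so Minkowski's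
  inequality in \<open>L\<^sup>p\<close> and induction give \<open>\<parallel>\<Sum>V\<^sub>i\<parallel>\<^sup>2 \<le> 4p \<Sum>\<parallel>V\<^sub>i\<parallel>\<^sup>2\<close>, where \<open>4p \<le> (20p)\<^sup>2\<close>.
\<close>

section \<open>Moments of martingales\<close>

text \<open>Compare ratios of consecutive terms. Passing from \<open>m\<close> to
  \<open>m + 1\<close> multiplies the left side by
  \<open>(2p - 2m) (2p - 2m - 1) / ((2m + 1) (2m + 2))\<close> and \<open>p choose m\<close> by
  \<open>(p - m) / (m + 1)\<close>; the quotient of these factors is
  \<open>(2p - 2m - 1) / (2m + 1)\<close>, at most \<open>2p\<close>.\<close>

lemma binomial_double_even_le:
  "real (2 * p choose (2 * m)) \<le> real (p choose m) * (2 * real p) ^ m"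
proof (induction m)
  case 0
  show ?case by simp
next
  case (Suc m)
  show ?case
  proof (cases "m < p")
    case False
    then show ?thesis by (simp add: binomial_eq_0)
  next
    case True
    let ?A = "real (2 * p choose (2 * m))" and ?A1 = "real (2 * p choose (2 * m + 1))"
      and ?A2 = "real (2 * p choose (2 * Suc m))"
      and ?B = "real (p choose m)" and ?B1 = "real (p choose Suc m)"
    have absorb: "real (Suc k) * real (n choose Suc k) = real (n - k) * real (n choose k)" for n k :: nat
      using binomial_absorb_comp[of n k] binomial_absorption[of k n]
      by (metis (no_types, opaque_lifting) of_nat_mult)
    have 1: "(2 * real m + 1) * ?A1 = (2 * real p - 2 * real m) * ?A"
      using absorb[of "2*m" "2*p"] True by (simp add: of_nat_diff algebra_simps)
    have 2: "(2 * real m + 2) * ?A2 = (2 * real p - 2 * real m - 1) * ?A1"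
      using absorb[of "2*m+1" "2*p"] True by (simp add: of_nat_diff algebra_simps)
    have 3: "(real m + 1) * ?B1 = (real p - real m) * ?B"
      using absorb[of "m" "p"] True by (simp add: of_nat_diff algebra_simps)
    have "(2 * real m + 1) * (2 * real m + 2) * ?A2
        = (2 * real p - 2 * real m - 1) * ((2 * real m + 1) * ?A1)"
      using arg_cong[OF 2, of "(*) (2 * real m + 1)"] by (simp only: mult_ac)
    also have "\<dots> = (2 * real p - 2 * real m - 1) * (2 * real p - 2 * real m) * ?A"
      unfolding 1 by simp
    also have "\<dots> \<le> (2 * real p - 2 * real m - 1) * (2 * real p - 2 * real m) * (?B * (2 * real p) ^ m)"
      using True by (intro mult_left_mono Suc.IH mult_nonneg_nonneg) auto
    also have "\<dots> = (2 * real p - 2 * real m - 1) * 2 * (2 * real p) ^ m * ((real p - real m) * ?B)"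
      by (simp add: algebra_simps)
    also have "\<dots> = (2 * real m + 2) * ((2 * real p - 2 * real m - 1) * ((2 * real p) ^ m * ?B1))"
      unfolding 3[symmetric] by (simp add: algebra_simps)
    also have "\<dots> \<le> (2 * real m + 2) * (((2 * real m + 1) * (2 * real p)) * ((2 * real p) ^ m * ?B1))"
    proof (intro mult_left_mono mult_right_mono)
      have "0 \<le> 2 * real m * (2 * real p)" by simp
      then show "2 * real p - 2 * real m - 1 \<le> (2 * real m + 1) * (2 * real p)"
        unfolding distrib_right by linarith
    qed auto
    finally have "(2 * real m + 1) * (2 * real m + 2) * ?A2
        \<le> (2 * real m + 1) * (2 * real m + 2) * (?B1 * (2 * real p) ^ Suc m)"
      by (simp only: mult_ac power_Suc)
    moreover have "0 < (2 * real m + 1) * (2 * real m + 2)" by simp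
    ultimately show ?thesis
      by (simp only: mult_le_cancel_left_pos)
  qed
qed

lemma power_sum_plus_power_diff:
  fixes s v :: real
  shows "(s + v) ^ (2 * p) + (s - v) ^ (2 * p)
    = 2 * (\<Sum>m\<le>p. real (2 * p choose (2 * m)) * (v\<^sup>2) ^ m * (s\<^sup>2) ^ (p - m))"
proof -
  define c where "c k = real (2 * p choose k) * v ^ k * s ^ (2 * p - k)" for k
  have even_diff: "2 * p - 2 * m = 2 * (p - m)" for m
    by simp
  have "(s + v) ^ (2 * p) = (\<Sum>k\<le>2*p. c k)"
    unfolding c_def add.commute[of s v] by (rule binomial_ring)
  moreover have "(- v + s) ^ (2 * p) = (\<Sum>k\<le>2*p. (-1) ^ k * c k)"
    unfolding binomial_ring
    by (intro sum.cong refl) (subst power_minus, simp only: c_def mult_ac)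
  ultimately have "(s + v) ^ (2 * p) + (s - v) ^ (2 * p) = (\<Sum>k\<le>2*p. c k + (-1) ^ k * c k)"
    by (simp only: sum.distrib) simp
  \<comment> \<open>Odd terms cancel. The range is extended by the odd index
    \<open>2 * p + 1\<close>, which contributes 0, so that it splits into pairs of an even and an
    odd index.\<close>
  also have "\<dots> = (\<Sum>k<2 * Suc p. if even k then 2 * c k else 0)"
    by (rule sum.mono_neutral_cong_left) (auto simp: c_def le_Suc_eq)
  also have "\<dots> = (\<Sum>m\<le>p. 2 * c (2 * m))"
    unfolding sum_split_even_odd by (simp add: lessThan_Suc_atMost)
  also have "\<dots> = 2 * (\<Sum>m\<le>p. real (2 * p choose (2 * m)) * (v\<^sup>2) ^ m * (s\<^sup>2) ^ (p - m))"
    unfolding sum_distrib_left c_def even_diff power_mult[of v 2] power_mult[of s 2]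
    by (simp only: mult_ac)
  finally show ?thesis .
qed

text \<open>A convex function lies above its tangents; the tangent at \<open>s\<close> is evaluated
  at \<open>s - v\<close>.\<close>

lemma even_power_ge_tangent:
  fixes s v :: real
  assumes "p \<ge> 1"
  shows "s ^ (2 * p) - 2 * real p * s ^ (2 * p - 1) * v \<le> (s - v) ^ (2 * p)"
proof -
  have "(s - v) ^ (2 * p) - s ^ (2 * p) \<ge> (2 * real p * s ^ (2 * p - 1)) * ((s - v) - s)"
  proof (rule convex_on_imp_above_tangent[where A = UNIV and f = "\<lambda>x. x ^ (2 * p)"])
    show "convex_on UNIV (\<lambda>x::real. x ^ (2 * p))"
      by (simp add: convex_power_even)
    show "((\<lambda>x. x ^ (2 * p)) has_real_derivative 2 * real p * s ^ (2 * p - 1)) (at s within UNIV)"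
      by (auto intro!: derivative_eq_intros)
  qed auto
  then show ?thesis by (simp add: algebra_simps)
qed

text \<open>Adding \<open>(s - v) ^ (2 * p)\<close> leaves only even powers of \<open>v\<close>, and
  the tangent bound removes it again at the price of the linear term. The rest is compared term by
  term with the binomial expansion of the \<open>p\<close>-th power on the right.\<close>

lemma power_add_le_linear_plus_square:
  fixes s v :: real
  assumes "p \<ge> 1"
  shows "(s + v) ^ (2 * p) \<le> (s\<^sup>2 + 4 * real p * v\<^sup>2) ^ p + 2 * real p * (s ^ (2 * p - 1) * v)"
proof -
  let ?t = "\<lambda>m. real (p choose m) * (4 * real p * v\<^sup>2) ^ m * (s\<^sup>2) ^ (p - m)"
  let ?u = "\<lambda>m. real (2 * p choose (2 * m)) * (v\<^sup>2) ^ m * (s\<^sup>2) ^ (p - m)"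
  \<comment> \<open>For \<open>m \<ge> 1\<close> the factor 2 is absorbed by \<open>2 ^ m\<close>,
    which turns the \<open>2 * p\<close> of \<open>binomial_double_even_le\<close> into
    \<open>4 * p\<close>. The term \<open>m = 0\<close> admits no such absorption and is split off
    below.\<close>
  have term_le: "2 * ?u m \<le> ?t m" if "m \<ge> 1" for m
  proof -
    have four: "4 * real p = 2 * (2 * real p)" by simp
    have "(2::real) \<le> 2 ^ m"
      using power_increasing[OF that, of "2::real"] by simp
    then have "2 * real (2 * p choose (2 * m)) \<le> 2 ^ m * (real (p choose m) * (2 * real p) ^ m)"
      by (intro mult_mono binomial_double_even_le) auto
    also have "\<dots> = real (p choose m) * (4 * real p) ^ m"
      unfolding four by (simp only: power_mult_distrib mult_ac)
    finally have "2 * real (2 * p choose (2 * m)) * ((v\<^sup>2) ^ m * (s\<^sup>2) ^ (p - m))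
        \<le> real (p choose m) * (4 * real p) ^ m * ((v\<^sup>2) ^ m * (s\<^sup>2) ^ (p - m))"
      by (intro mult_right_mono) auto
    then show ?thesis
      by (simp only: power_mult_distrib mult_ac)
  qed
  have split0: "(\<Sum>m\<le>p. f m) = f 0 + (\<Sum>m=1..p. f m)" for f :: "nat \<Rightarrow> real"
    using sum.atLeast_Suc_atMost[of 0 p f] by (simp add: atLeast0AtMost)
  have "(s + v) ^ (2 * p) + (s - v) ^ (2 * p) = 2 * s ^ (2 * p) + (\<Sum>m=1..p. 2 * ?u m)"
    unfolding power_sum_plus_power_diff split0 distrib_left sum_distrib_left
    by (simp only: power_mult) simp
  also have "(\<Sum>m=1..p. 2 * ?u m) \<le> (\<Sum>m=1..p. ?t m)"
    by (intro sum_mono term_le) auto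
  also have "\<dots> = (4 * real p * v\<^sup>2 + s\<^sup>2) ^ p - s ^ (2 * p)"
    unfolding binomial_ring split0 by (simp only: power_mult) simp
  finally have "(s + v) ^ (2 * p) + (s - v) ^ (2 * p)
      \<le> 2 * s ^ (2 * p) + ((4 * real p * v\<^sup>2 + s\<^sup>2) ^ p - s ^ (2 * p))"
    by simp
  moreover have "s ^ (2 * p) - 2 * real p * (s ^ (2 * p - 1) * v) \<le> (s - v) ^ (2 * p)"
    using even_power_ge_tangent[OF assms, of s v] by (simp only: mult.assoc)
  ultimately show ?thesis
    unfolding add.commute[of "s\<^sup>2"] by linarith
qed

section \<open>Minkowski's inequality for integer exponents\<close>

lemma convex_on_nonneg_power: "convex_on {0::real..} (\<lambda>x. x ^ q)"
  by (cases "even q") (auto intro: convex_power_odd convex_on_subset[OF convex_power_even])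

text \<open>Convexity of \<open>x ^ q\<close> at the points \<open>u / a\<close> and
  \<open>v / b\<close> with weights \<open>a / (a + b)\<close> and \<open>b / (a + b)\<close>. If
  \<open>a\<close> and \<open>b\<close> bound the \<open>L^q\<close> norms of functions
  \<open>u\<close> and \<open>v\<close>, the last factor integrates to at most 1.\<close>

lemma power_add_weighted_le:
  fixes u v a b :: real
  assumes "0 \<le> u" "0 \<le> v" "0 < a" "0 < b"
  shows "(u + v) ^ q \<le> (a + b) ^ q * (a / (a + b) * (u ^ q / a ^ q) + b / (a + b) * (v ^ q / b ^ q))"
proof -
  have "(a / (a + b) * (u / a) + b / (a + b) * (v / b)) ^ q
      \<le> a / (a + b) * (u / a) ^ q + b / (a + b) * (v / b) ^ q"
  proof -
    have "((1 - b / (a + b)) *\<^sub>R (u / a) + (b / (a + b)) *\<^sub>R (v / b)) ^ q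
      \<le> (1 - b / (a + b)) * (u / a) ^ q + (b / (a + b)) * (v / b) ^ q"
      using assms by (intro convex_onD[OF convex_on_nonneg_power]) auto
    moreover have "1 - b / (a + b) = a / (a + b)"
      using assms by (simp add: field_simps)
    ultimately show ?thesis by simp
  qed
  moreover have "a / (a + b) * (u / a) + b / (a + b) * (v / b) = (u + v) / (a + b)"
    using assms by (simp add: add_divide_distrib)
  ultimately have "((u + v) / (a + b)) ^ q \<le> a / (a + b) * (u ^ q / a ^ q) + b / (a + b) * (v ^ q / b ^ q)"
    by (simp add: power_divide)
  then have "(a + b) ^ q * ((u + v) / (a + b)) ^ q
      \<le> (a + b) ^ q * (a / (a + b) * (u ^ q / a ^ q) + b / (a + b) * (v ^ q / b ^ q))"
    using assms by (intro mult_left_mono) auto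
  moreover have "(a + b) ^ q * ((u + v) / (a + b)) ^ q = (u + v) ^ q"
    using assms by (simp add: power_mult_distrib[symmetric])
  ultimately show ?thesis by simp
qed

text \<open>Stating the bounds as \<open>a ^ q\<close> and \<open>b ^ q\<close> avoids roots and
  gives a conclusion of the same shape, ready for induction.\<close>

lemma Minkowski_power:
  fixes u v :: "'b \<Rightarrow> real"
  assumes [measurable]: "u \<in> borel_measurable M" "v \<in> borel_measurable M"
    and nonneg: "\<And>x. x \<in> space M \<Longrightarrow> 0 \<le> u x" "\<And>x. x \<in> space M \<Longrightarrow> 0 \<le> v x"
    and int: "integrable M (\<lambda>x. u x ^ q)" "integrable M (\<lambda>x. v x ^ q)"
    and le: "(\<integral>x. u x ^ q \<partial>M) \<le> a ^ q" "(\<integral>x. v x ^ q \<partial>M) \<le> b ^ q"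
    and ab: "0 \<le> a" "0 \<le> b"
  shows "integrable M (\<lambda>x. (u x + v x) ^ q)" "(\<integral>x. (u x + v x) ^ q \<partial>M) \<le> (a + b) ^ q"
proof -
  \<comment> \<open>Convexity needs positive weights, so \<open>a\<close> and \<open>b\<close>, which may be 0, are increased by \<open>\<epsilon>\<close>.\<close>
  define dom where "dom \<epsilon> x = (a + \<epsilon> + (b + \<epsilon>)) ^ q * ((a + \<epsilon>) / (a + \<epsilon> + (b + \<epsilon>)) * (u x ^ q / (a + \<epsilon>) ^ q)
      + (b + \<epsilon>) / (a + \<epsilon> + (b + \<epsilon>)) * (v x ^ q / (b + \<epsilon>) ^ q))" for \<epsilon> x
  have dom_int: "integrable M (dom \<epsilon>)" for \<epsilon>
    unfolding dom_def using int by auto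
  have dom_ge: "(u x + v x) ^ q \<le> dom \<epsilon> x" if "\<epsilon> > 0" "x \<in> space M" for \<epsilon> x
    unfolding dom_def using that nonneg ab by (intro power_add_weighted_le) auto
  show int_sum: "integrable M (\<lambda>x. (u x + v x) ^ q)"
  proof (rule Bochner_Integration.integrable_bound[OF dom_int[of 1]])
    show "AE x in M. norm ((u x + v x) ^ q) \<le> norm (dom 1 x)"
      using dom_ge[of 1] nonneg by (intro AE_I2) (smt (verit) real_norm_def zero_le_power)
  qed simp
  have "(\<integral>x. (u x + v x) ^ q \<partial>M) \<le> (a + \<epsilon> + (b + \<epsilon>)) ^ q" if "\<epsilon> > 0" for \<epsilon>
  proof -
    have "(\<integral>x. (u x + v x) ^ q \<partial>M) \<le> (\<integral>x. dom \<epsilon> x \<partial>M)"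
      by (intro integral_mono int_sum dom_int dom_ge that)
    also have "\<dots> = (a + \<epsilon> + (b + \<epsilon>)) ^ q * ((a + \<epsilon>) / (a + \<epsilon> + (b + \<epsilon>)) * ((\<integral>x. u x ^ q \<partial>M) / (a + \<epsilon>) ^ q)
      + (b + \<epsilon>) / (a + \<epsilon> + (b + \<epsilon>)) * ((\<integral>x. v x ^ q \<partial>M) / (b + \<epsilon>) ^ q))"
      unfolding dom_def using int by simp
    also have "\<dots> \<le> (a + \<epsilon> + (b + \<epsilon>)) ^ q * ((a + \<epsilon>) / (a + \<epsilon> + (b + \<epsilon>)) * 1
      + (b + \<epsilon>) / (a + \<epsilon> + (b + \<epsilon>)) * 1)"
    proof (intro mult_left_mono add_mono)
      have "a ^ q \<le> (a + \<epsilon>) ^ q" "b ^ q \<le> (b + \<epsilon>) ^ q"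
        using ab that by (auto intro: power_mono)
      then show "(\<integral>x. u x ^ q \<partial>M) / (a + \<epsilon>) ^ q \<le> 1" "(\<integral>x. v x ^ q \<partial>M) / (b + \<epsilon>) ^ q \<le> 1"
        using le ab that by (auto simp: divide_le_eq)
    qed (use ab that in auto)
    also have "\<dots> = (a + \<epsilon> + (b + \<epsilon>)) ^ q"
      using ab that by (simp add: add_divide_distrib[symmetric])
    finally show ?thesis .
  qed
  then have "eventually (\<lambda>\<epsilon>. (\<integral>x. (u x + v x) ^ q \<partial>M) \<le> (a + \<epsilon> + (b + \<epsilon>)) ^ q) (at_right 0)"
    by (auto simp: eventually_at_filter)
  moreover have "((\<lambda>\<epsilon>. (a + \<epsilon> + (b + \<epsilon>)) ^ q) \<longlongrightarrow> (a + 0 + (b + 0)) ^ q) (at_right 0)"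
    by (intro tendsto_intros)
  ultimately show "(\<integral>x. (u x + v x) ^ q \<partial>M) \<le> (a + b) ^ q"
    using tendsto_lowerbound[of "\<lambda>\<epsilon>. (a + \<epsilon> + (b + \<epsilon>)) ^ q" _ "at_right 0"] by simp
qed

lemma Minkowski_power_sum:
  fixes u :: "'i \<Rightarrow> 'b \<Rightarrow> real"
  assumes "finite J" "q \<ge> 1"
    and meas: "\<And>j. j \<in> J \<Longrightarrow> u j \<in> borel_measurable M"
    and nonneg: "\<And>j x. j \<in> J \<Longrightarrow> x \<in> space M \<Longrightarrow> 0 \<le> u j x"
    and int: "\<And>j. j \<in> J \<Longrightarrow> integrable M (\<lambda>x. u j x ^ q)"
    and le: "\<And>j. j \<in> J \<Longrightarrow> (\<integral>x. u j x ^ q \<partial>M) \<le> w j ^ q"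
    and w: "\<And>j. j \<in> J \<Longrightarrow> 0 \<le> w j"
  shows "integrable M (\<lambda>x. (\<Sum>j\<in>J. u j x) ^ q)" "(\<integral>x. (\<Sum>j\<in>J. u j x) ^ q \<partial>M) \<le> (\<Sum>j\<in>J. w j) ^ q"
proof -
  have "integrable M (\<lambda>x. (\<Sum>j\<in>J. u j x) ^ q) \<and>
        (\<integral>x. (\<Sum>j\<in>J. u j x) ^ q \<partial>M) \<le> (\<Sum>j\<in>J. w j) ^ q"
    using \<open>finite J\<close> meas nonneg int le w
  proof (induction J)
    case empty
    \<comment> \<open>The empty sum is 0, and \<open>0 ^ q = 0\<close> relies on
      \<open>q \<ge> 1\<close>.\<close>
    show ?case using \<open>q \<ge> 1\<close> by (simp add: power_0_left)
  next
    case (insert j J)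
    have IH: "integrable M (\<lambda>x. (\<Sum>j\<in>J. u j x) ^ q) \<and>
        (\<integral>x. (\<Sum>j\<in>J. u j x) ^ q \<partial>M) \<le> (\<Sum>j\<in>J. w j) ^ q"
      by (rule insert.IH) (use insert.prems in auto)
    have m: "(\<lambda>x. \<Sum>j\<in>J. u j x) \<in> borel_measurable M"
      using insert.prems(1) by (intro borel_measurable_sum) auto
    have nn: "0 \<le> (\<Sum>j\<in>J. u j x)" if "x \<in> space M" for x
      using insert.prems(2) that by (intro sum_nonneg) auto
    have wn: "0 \<le> (\<Sum>j\<in>J. w j)"
      using insert.prems(5) by (intro sum_nonneg) auto
    show ?case
      using Minkowski_power[of "u j" M "\<lambda>x. \<Sum>j\<in>J. u j x" q "w j" "\<Sum>j\<in>J. w j"]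
        insert.prems IH m nn wn insert.hyps by simp
  qed
  then show "integrable M (\<lambda>x. (\<Sum>j\<in>J. u j x) ^ q)"
    "(\<integral>x. (\<Sum>j\<in>J. u j x) ^ q \<partial>M) \<le> (\<Sum>j\<in>J. w j) ^ q" by auto
qed

text \<open>The martingale property enters as \<open>orth\<close>, the vanishing of the linear term
  of the pointwise inequality, so no filtration appears. Boundedness provides all
  integrability.\<close>

lemma (in prob_space) martingale_moment_le:
  fixes S :: "nat \<Rightarrow> 'a \<Rightarrow> real" and W :: "nat \<Rightarrow> real"
  assumes "p \<ge> 1"
    and meas [measurable]: "\<And>k. S k \<in> borel_measurable M"
    and bounded: "\<And>k x. x \<in> space M \<Longrightarrow> \<bar>S k x\<bar> \<le> B k"
    and "\<And>x. x \<in> space M \<Longrightarrow> S 0 x = 0"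
    and orth: "\<And>k. k < N \<Longrightarrow> (\<integral>x. S k x ^ (2 * p - 1) * (S (Suc k) x - S k x) \<partial>M) = 0"
    and incr: "\<And>k. k < N \<Longrightarrow> (\<integral>x. (S (Suc k) x - S k x) ^ (2 * p) \<partial>M) \<le> W k ^ (2 * p)"
  shows "(\<integral>x. S N x ^ (2 * p) \<partial>M) \<le> (4 * real p * (\<Sum>k<N. (W k)\<^sup>2)) ^ p"
  using orth incr
proof (induction N)
  case 0
  have "(\<integral>x. S 0 x ^ (2 * p) \<partial>M) = (\<integral>x. 0 \<partial>M)"
    using assms by (intro Bochner_Integration.integral_cong) auto
  then show ?case by simp
next
  case (Suc N)
  have IH: "(\<integral>x. S N x ^ (2 * p) \<partial>M) \<le> (4 * real p * (\<Sum>k<N. (W k)\<^sup>2)) ^ p"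
    using Suc by simp
  let ?V = "\<lambda>x. S (Suc N) x - S N x"
  have B: "\<bar>?V x\<bar> \<le> B N + B (Suc N)" if "x \<in> space M" for x
    using bounded[OF that, of N] bounded[OF that, of "Suc N"] by linarith
  have int_S: "integrable M (\<lambda>x. S k x ^ r)" for k r
    using bounded by (intro integrable_const_bound[where B = "B k ^ r"] AE_I2)
      (auto simp: power_abs intro: power_mono)
  have int_V: "integrable M (\<lambda>x. ?V x ^ r)" for r
  proof (intro integrable_const_bound[where B = "(B N + B (Suc N)) ^ r"] AE_I2)
    fix x assume "x \<in> space M"
    then show "norm (?V x ^ r) \<le> (B N + B (Suc N)) ^ r"
      unfolding real_norm_def power_abs by (intro power_mono B) auto
  qed simp
  have int_cross: "integrable M (\<lambda>x. S N x ^ r * ?V x)" for r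
  proof (intro integrable_const_bound[where B = "B N ^ r * (B N + B (Suc N))"] AE_I2)
    fix x assume x: "x \<in> space M"
    show "norm (S N x ^ r * ?V x) \<le> B N ^ r * (B N + B (Suc N))"
      unfolding real_norm_def abs_mult power_abs
      using bounded[OF x, of N] B[OF x] by (intro mult_mono power_mono) auto
  qed simp
  have 1: "integrable M (\<lambda>x. ((S N x)\<^sup>2) ^ p)" "integrable M (\<lambda>x. (4 * real p * (?V x)\<^sup>2) ^ p)"
    using int_S[of N "2 * p"] int_V[of "2 * p"] by (simp_all add: power_mult power_mult_distrib)
  have 2: "(\<integral>x. ((S N x)\<^sup>2) ^ p \<partial>M) \<le> (4 * real p * (\<Sum>k<N. (W k)\<^sup>2)) ^ p"
    using IH by (simp add: power_mult)
  have 3: "(\<integral>x. (4 * real p * (?V x)\<^sup>2) ^ p \<partial>M) \<le> (4 * real p * (W N)\<^sup>2) ^ p"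
    using Suc.prems(2)[of N] by (simp add: power_mult_distrib power_mult mult_left_mono)
  have 4: "0 \<le> 4 * real p * (\<Sum>k<N. (W k)\<^sup>2)" "0 \<le> 4 * real p * (W N)\<^sup>2"
    by (intro mult_nonneg_nonneg sum_nonneg; simp)+
  \<comment> \<open>Minkowski with exponent \<open>p\<close> for the squares
    \<open>(S N x)^2\<close> and \<open>4p (?V x)^2\<close>. The induction hypothesis bounds the
    first \<open>L^p\<close> norm, and the new squared weight is simply added.\<close>
  have quad: "integrable M (\<lambda>x. ((S N x)\<^sup>2 + 4 * real p * (?V x)\<^sup>2) ^ p)"
    "(\<integral>x. ((S N x)\<^sup>2 + 4 * real p * (?V x)\<^sup>2) ^ p \<partial>M)
      \<le> (4 * real p * (\<Sum>k<N. (W k)\<^sup>2) + 4 * real p * (W N)\<^sup>2) ^ p"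
    by (rule Minkowski_power[OF _ _ _ _ 1 2 3 4]; simp)+
  have "(\<integral>x. S (Suc N) x ^ (2 * p) \<partial>M)
      \<le> (\<integral>x. ((S N x)\<^sup>2 + 4 * real p * (?V x)\<^sup>2) ^ p + 2 * real p * (S N x ^ (2 * p - 1) * ?V x) \<partial>M)"
  proof (intro integral_mono int_S)
    show "integrable M (\<lambda>x. ((S N x)\<^sup>2 + 4 * real p * (?V x)\<^sup>2) ^ p + 2 * real p * (S N x ^ (2 * p - 1) * ?V x))"
      using quad(1) int_cross[of "2*p-1"] by auto
    show "S (Suc N) x ^ (2 * p)
        \<le> ((S N x)\<^sup>2 + 4 * real p * (?V x)\<^sup>2) ^ p + 2 * real p * (S N x ^ (2 * p - 1) * ?V x)" for x
      using power_add_le_linear_plus_square[OF \<open>p \<ge> 1\<close>, of "S N x" "?V x"] by simp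
  qed
  also have "\<dots> = (\<integral>x. ((S N x)\<^sup>2 + 4 * real p * (?V x)\<^sup>2) ^ p \<partial>M)"
    using quad(1) int_cross[of "2*p-1"] Suc.prems(1)[of N] by simp
  also note quad(2)
  finally show ?case by (simp add: distrib_left)
qed

section \<open>Functions of finitely many coordinates\<close>

lemma space_seq_space: "space (seq_space I) = I \<rightarrow>\<^sub>E UNIV"
  by (simp add: seq_space_def space_PiM)

lemma seq_space_finite: "finite I \<Longrightarrow> seq_space I = count_space (I \<rightarrow>\<^sub>E UNIV)"
  unfolding seq_space_def by (intro count_space_PiM_finite) (auto intro: countable_finite)

lemma finite_PiE_UNIV: "finite J \<Longrightarrow> finite (J \<rightarrow>\<^sub>E (UNIV :: 'a::finite set))"
  by (intro finite_PiE) auto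

lemma measurable_restrict_seq_space:
  "J \<subseteq> I \<Longrightarrow> (\<lambda>\<sigma>. restrict \<sigma> J) \<in> measurable (seq_space I) (seq_space J)"
  unfolding seq_space_def by (rule measurable_restrict_subset)

text \<open>Over a finite index set the product sigma-algebra is the full power set, so an arbitrary
  \<open>F\<close> is measurable. Only the sigma-algebra of \<open>N\<close> is prescribed, so that
  this serves both \<open>P\<close> and the kernels \<open>K i x\<close>.\<close>

lemma measurable_fun_restrict:
  fixes F :: "(nat \<Rightarrow> 'a::finite) \<Rightarrow> real"
  assumes "sets N = sets (seq_space I)" "J \<subseteq> I" "finite J"
  shows "(\<lambda>\<sigma>. F (restrict \<sigma> J)) \<in> borel_measurable N"
proof -
  have "F \<in> borel_measurable (seq_space J)"
    using assms by (simp add: seq_space_finite)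
  then have "(\<lambda>\<sigma>. F (restrict \<sigma> J)) \<in> borel_measurable (seq_space I)"
    by (rule measurable_compose[OF measurable_restrict_seq_space[OF assms(2)]])
  then show ?thesis
    using assms(1) by (simp cong: measurable_cong_sets)
qed

lemma bounded_fun_restrict:
  fixes F :: "(nat \<Rightarrow> 'a::finite) \<Rightarrow> real"
  assumes "finite J"
  obtains B where "\<And>\<sigma>. \<bar>F (restrict \<sigma> J)\<bar> \<le> B"
proof
  have fin: "finite ((\<lambda>y. \<bar>F y\<bar>) ` (J \<rightarrow>\<^sub>E UNIV))"
    using assms by (intro finite_imageI finite_PiE_UNIV)
  show "\<bar>F (restrict \<sigma> J)\<bar> \<le> Max ((\<lambda>y. \<bar>F y\<bar>) ` (J \<rightarrow>\<^sub>E UNIV))" for \<sigma>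
    by (rule Max_ge[OF fin]) auto
qed

lemma integrable_fun_restrict:
  fixes F :: "(nat \<Rightarrow> 'a::finite) \<Rightarrow> real"
  assumes "prob_space N" "sets N = sets (seq_space I)" "J \<subseteq> I" "finite J"
  shows "integrable N (\<lambda>\<sigma>. F (restrict \<sigma> J))"
proof -
  interpret prob_space N by fact
  obtain B where "\<And>\<sigma>. \<bar>F (restrict \<sigma> J)\<bar> \<le> B"
    using bounded_fun_restrict[OF \<open>finite J\<close>] by blast
  then show ?thesis
    by (intro integrable_const_bound[where B = B] measurable_fun_restrict[OF assms(2-4)] AE_I2) auto
qed

text \<open>Serves two purposes: joining a past to a future drawn from \<open>K i x\<close>, and
  interpolating between two sequences coordinate by coordinate.\<close>

definition splice_seq :: "nat \<Rightarrow> (nat \<Rightarrow> 'a) \<Rightarrow> (nat \<Rightarrow> 'a) \<Rightarrow> nat \<Rightarrow> 'a" where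
  "splice_seq i x \<eta> = (\<lambda>j. if j \<le> i then x j else \<eta> j)"

lemma cylinder_fun_cong:
  "(\<And>j. j \<in> {1..n} \<Longrightarrow> \<sigma> j = \<tau> j) \<Longrightarrow> cylinder_fun n g \<sigma> = cylinder_fun n g \<tau>"
  unfolding cylinder_fun_def by (intro arg_cong[of _ _ g] restrict_ext) simp

lemma cylinder_fun_splice_restrict:
  "cylinder_fun n g (splice_seq i x \<eta>) = cylinder_fun n g (splice_seq i x (restrict \<eta> {i+1..n}))"
  by (rule cylinder_fun_cong) (auto simp: splice_seq_def)

lemma integrable_cylinder_splice:
  fixes g :: "(nat \<Rightarrow> 'a::finite) \<Rightarrow> real"
  assumes "prob_space N" "sets N = sets (seq_space {i+1..})"
  shows "integrable N (\<lambda>\<eta>. cylinder_fun n g (splice_seq i x \<eta>))"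
proof -
  have "integrable N (\<lambda>\<eta>. cylinder_fun n g (splice_seq i x (restrict \<eta> {i+1..n})))"
    by (rule integrable_fun_restrict[OF assms]) auto
  then show ?thesis
    by (simp only: cylinder_fun_splice_restrict[symmetric])
qed

section \<open>Variation of a cylinder function\<close>

text \<open>Needed because a real \<open>Sup\<close> is guaranteed to dominate its set only when
  that set is bounded above.\<close>

lemma variation_bdd_above:
  "bdd_above {\<bar>cylinder_fun n g \<sigma> - cylinder_fun n g \<sigma>'\<bar> | \<sigma> \<sigma>'.
     \<sigma> \<in> space (seq_space {1..}) \<and> \<sigma>' \<in> space (seq_space {1..}) \<and> (\<forall>j. j \<noteq> i \<longrightarrow> \<sigma> j = \<sigma>' j)}"
proof -
  obtain B where B: "\<And>\<sigma>. \<bar>g (restrict \<sigma> {1..n})\<bar> \<le> B"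
    using bounded_fun_restrict[of "{1..n}" g] by blast
  have "\<bar>cylinder_fun n g \<sigma> - cylinder_fun n g \<sigma>'\<bar> \<le> 2 * B" for \<sigma> \<sigma>'
    using B[of \<sigma>] B[of \<sigma>'] unfolding cylinder_fun_def by linarith
  then show ?thesis by (intro bdd_aboveI[of _ "2 * B"]) auto
qed

lemma abs_diff_le_variation:
  assumes "\<sigma> \<in> {1..} \<rightarrow>\<^sub>E UNIV" "\<tau> \<in> {1..} \<rightarrow>\<^sub>E UNIV" "\<And>j. j \<noteq> i \<Longrightarrow> \<sigma> j = \<tau> j"
  shows "\<bar>cylinder_fun n g \<sigma> - cylinder_fun n g \<tau>\<bar> \<le> variation (cylinder_fun n g) i"
  unfolding variation_def using assms
  by (intro cSup_upper variation_bdd_above) (auto simp: space_seq_space)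

lemma variation_nonneg: "0 \<le> variation (cylinder_fun n g) i"
  using abs_diff_le_variation[of "restrict (\<lambda>_. undefined) {1..}" "restrict (\<lambda>_. undefined) {1..}" i n g]
  by simp

lemma variation_eq_0:
  assumes "i > n"
  shows "variation (cylinder_fun n (g :: (nat \<Rightarrow> 'a::finite) \<Rightarrow> real)) i = 0"
proof -
  have "cylinder_fun n g \<sigma> = cylinder_fun n g \<tau>" if "\<And>j. j \<noteq> i \<Longrightarrow> \<sigma> j = \<tau> j" for \<sigma> \<tau>
    using that assms by (intro cylinder_fun_cong) auto
  moreover have "restrict (\<lambda>_. undefined :: 'a) {1..} \<in> space (seq_space {1..})"
    by (simp add: space_seq_space)
  ultimately have "{\<bar>cylinder_fun n g \<sigma> - cylinder_fun n g \<sigma>'\<bar> | \<sigma> \<sigma>'. \<sigma> \<in> space (seq_space {1..}) \<and>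
      \<sigma>' \<in> space (seq_space {1..}) \<and> (\<forall>j. j \<noteq> i \<longrightarrow> \<sigma> j = \<sigma>' j)} = {0}"
    by fastforce
  then show ?thesis unfolding variation_def by simp
qed

text \<open>Replace the coordinates of \<open>\<sigma>\<close> by those of \<open>\<tau>\<close> one
  at a time and telescope: the replacement at \<open>j\<close> costs at most the variation there,
  and nothing if the letters agree.\<close>

lemma abs_diff_le_sum_variation:
  assumes \<sigma>: "\<sigma> \<in> {1..} \<rightarrow>\<^sub>E UNIV" and \<tau>: "\<tau> \<in> {1..} \<rightarrow>\<^sub>E UNIV"
  shows "\<bar>cylinder_fun n g \<sigma> - cylinder_fun n g \<tau>\<bar>
    \<le> (\<Sum>j=1..n. variation (cylinder_fun n g) j * of_bool (\<sigma> j \<noteq> \<tau> j))"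
proof -
  let ?f = "cylinder_fun n g"
  have in_space: "splice_seq k \<tau> \<sigma> \<in> {1..} \<rightarrow>\<^sub>E UNIV" for k
    using assms by (auto simp: splice_seq_def PiE_iff extensional_def)
  have "\<bar>?f \<sigma> - ?f (splice_seq k \<tau> \<sigma>)\<bar> \<le> (\<Sum>j=1..k. variation ?f j * of_bool (\<sigma> j \<noteq> \<tau> j))" for k
  proof (induction k)
    case 0
    \<comment> \<open>Splicing at 0 can alter only coordinate 0, which lies outside
      \<open>{1..n}\<close>.\<close>
    have "?f \<sigma> = ?f (splice_seq 0 \<tau> \<sigma>)"
      by (rule cylinder_fun_cong) (simp add: splice_seq_def)
    then show ?case by simp
  next
    case (Suc k)
    have "\<bar>?f (splice_seq k \<tau> \<sigma>) - ?f (splice_seq (Suc k) \<tau> \<sigma>)\<bar>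
        \<le> variation ?f (Suc k) * of_bool (\<sigma> (Suc k) \<noteq> \<tau> (Suc k))"
    proof (cases "\<sigma> (Suc k) = \<tau> (Suc k)")
      case True
      then have "splice_seq k \<tau> \<sigma> = splice_seq (Suc k) \<tau> \<sigma>"
        by (auto simp: splice_seq_def fun_eq_iff le_Suc_eq)
      with True show ?thesis by simp
    next
      case False
      then show ?thesis
        using abs_diff_le_variation[OF in_space in_space, of "Suc k" k "Suc k" n g]
        by (auto simp: splice_seq_def)
    qed
    with Suc.IH show ?case by simp
  qed
  moreover have "?f (splice_seq n \<tau> \<sigma>) = ?f \<tau>"
    by (rule cylinder_fun_cong) (simp add: splice_seq_def)
  ultimately show ?thesis by metis
qed

text \<open>Summability matters here: \<open>infsum\<close> of a non-summable family is 0 by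
  default.\<close>

lemma sum_le_l2_norm_power2:
  assumes "in_l2 x"
  shows "(\<Sum>i=1..n. (x i)\<^sup>2) \<le> (l2_norm x)\<^sup>2"
proof -
  have "(\<Sum>i=1..n. (x i)\<^sup>2) \<le> (\<Sum>\<^sub>\<infinity>i\<in>{1..}. (x i)\<^sup>2)"
    using assms unfolding in_l2_def by (intro finite_sum_le_infsum) auto
  moreover have "0 \<le> (\<Sum>\<^sub>\<infinity>i\<in>{1..}. (x i)\<^sup>2)"
    by (rule infsum_nonneg) simp
  ultimately show ?thesis
    by (simp add: l2_norm_def)
qed

section \<open>Martingale differences and the coupling matrix\<close>

locale coupled_cylinder = prob_space P for P :: "(nat \<Rightarrow> 'a::finite) measure" +
  fixes K :: "nat \<Rightarrow> (nat \<Rightarrow> 'a) \<Rightarrow> (nat \<Rightarrow> 'a) measure"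
    and Q :: "nat \<Rightarrow> (nat \<Rightarrow> 'a) \<Rightarrow> 'a \<Rightarrow> 'a \<Rightarrow> ((nat \<Rightarrow> 'a) \<times> (nat \<Rightarrow> 'a)) measure"
    and g :: "(nat \<Rightarrow> 'a) \<Rightarrow> real" and n :: nat
  assumes sets_P: "sets P = sets (seq_space {1..})"
    and versions: "conditional_versions P K"
    and couplings: "maximal_couplings K Q"
begin

abbreviation "f \<equiv> cylinder_fun n g"
abbreviation "D \<equiv> coupling_matrix Q"
abbreviation "\<delta> \<equiv> variation f"

lemmas integrable_prefix = integrable_fun_restrict[OF prob_space_axioms sets_P]
lemmas measurable_prefix = measurable_fun_restrict[OF sets_P]

lemma K_prob:
  assumes "i \<ge> 1" "x \<in> {1..i} \<rightarrow>\<^sub>E UNIV"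
  shows "prob_space (K i x)" "sets (K i x) = sets (seq_space {i+1..})"
  using versions assms unfolding conditional_versions_def by blast+

section \<open>Conditional expectations given a finite prefix\<close>

definition cylinder :: "nat \<Rightarrow> (nat \<Rightarrow> 'a) \<Rightarrow> (nat \<Rightarrow> 'a) set" where
  "cylinder i x = {\<sigma> \<in> space P. restrict \<sigma> {1..i} = x}"

lemma cylinder_sets [measurable]: "cylinder i x \<in> sets P"
proof -
  have "(\<lambda>\<sigma>. of_bool (restrict \<sigma> {1..i} = x) :: real) \<in> borel_measurable P"
    by (rule measurable_prefix[where F = "\<lambda>y. of_bool (y = x)"]) auto
  then have "{\<sigma> \<in> space P. of_bool (restrict \<sigma> {1..i} = x) = (1::real)} \<in> sets P"
    by measurable
  then show ?thesis by (simp add: cylinder_def)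
qed

text \<open>The conditional expectation of \<open>f\<close> as a function of the prefix, so that
  \<open>h i\<close> below is the Doob martingale of \<open>f\<close>. The case \<open>i = 0\<close>
  is separate because \<open>conditional_versions\<close> prescribes \<open>K i\<close> only for
  \<open>i \<ge> 1\<close>.\<close>

definition integral_given :: "nat \<Rightarrow> (nat \<Rightarrow> 'a) \<Rightarrow> real" where
  "integral_given i x =
     (if i = 0 then (\<integral>\<tau>. f \<tau> \<partial>P) else (\<integral>\<eta>. f (splice_seq i x \<eta>) \<partial>K i x))"

abbreviation "h i \<sigma> \<equiv> integral_given i (restrict \<sigma> {1..i})"

lemma integrable_f: "integrable P f"
  unfolding cylinder_fun_def by (rule integrable_prefix) auto

text \<open>On a cylinder of positive probability \<open>conditional_versions\<close> fixes the mass
  of every measurable set, which determines the measure. This converts integrals against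
  \<open>K i x\<close> into integrals against \<open>P\<close>.\<close>

lemma K_eq_distr:
  assumes i: "i \<ge> 1" and x: "x \<in> {1..i} \<rightarrow>\<^sub>E UNIV" and pos: "prob (cylinder i x) > 0"
  shows "K i x = distr (uniform_measure P (cylinder i x)) (seq_space {i+1..}) (\<lambda>\<sigma>. restrict \<sigma> {i+1..})"
proof -
  let ?U = "uniform_measure P (cylinder i x)"
  interpret Kx: prob_space "K i x" by (rule K_prob[OF i x])
  interpret U: prob_space ?U
    using pos by (intro prob_space_uniform_measure) (auto simp: emeasure_eq_measure)
  have meas: "(\<lambda>\<sigma>. restrict \<sigma> {i+1..}) \<in> measurable P (seq_space {i+1..})"
    using measurable_restrict_seq_space[of "{i+1..}" "{1..}"] sets_P
    by (simp cong: measurable_cong_sets)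
  then have meas_U: "(\<lambda>\<sigma>. restrict \<sigma> {i+1..}) \<in> measurable ?U (seq_space {i+1..})"
    by simp
  interpret V: prob_space "distr ?U (seq_space {i+1..}) (\<lambda>\<sigma>. restrict \<sigma> {i+1..})"
    by (rule U.prob_space_distr[OF meas_U])
  show ?thesis
  proof (rule measure_eqI)
    fix B assume "B \<in> sets (K i x)"
    then have B: "B \<in> sets (seq_space {i+1..})"
      using K_prob[OF i x] by simp
    have "measure (K i x) B = cond_prob P (\<lambda>\<eta>. restrict \<eta> {i+1..} \<in> B) (\<lambda>\<eta>. restrict \<eta> {1..i} = x)"
      using versions i x pos B unfolding conditional_versions_def cylinder_def by blast
    also have "\<dots> = prob ((\<lambda>\<sigma>. restrict \<sigma> {i+1..}) -` B \<inter> space P \<inter> cylinder i x) / prob (cylinder i x)"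
      unfolding cond_prob_def cylinder_def
      by (intro arg_cong2[of _ _ _ _ "(/)"] arg_cong[of _ _ prob]) auto
    also have "\<dots> = measure ?U ((\<lambda>\<sigma>. restrict \<sigma> {i+1..}) -` B \<inter> space P)"
      using pos measurable_sets[OF meas B]
      by (subst measure_uniform_measure) (auto simp: emeasure_eq_measure Int_commute)
    also have "\<dots> = measure (distr ?U (seq_space {i+1..}) (\<lambda>\<sigma>. restrict \<sigma> {i+1..})) B"
      using B meas_U by (simp add: measure_distr)
    finally show "emeasure (K i x) B = emeasure (distr ?U (seq_space {i+1..}) (\<lambda>\<sigma>. restrict \<sigma> {i+1..})) B"
      by (simp only: Kx.emeasure_eq_measure V.emeasure_eq_measure)
  qed (use K_prob[OF i x] in simp)
qed

text \<open>The defining property of conditional expectation on an atom of the partition by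
  prefixes. On a null cylinder both sides vanish, whichever version was chosen; on a positive one
  \<open>K_eq_distr\<close> applies.\<close>

lemma integral_cylinder:
  assumes x: "x \<in> {1..i} \<rightarrow>\<^sub>E UNIV"
  shows "(\<integral>\<sigma>. indicator (cylinder i x) \<sigma> * f \<sigma> \<partial>P) = prob (cylinder i x) * integral_given i x"
proof -
  consider "i = 0" | "prob (cylinder i x) = 0" | "i \<ge> 1" "prob (cylinder i x) > 0"
    using measure_nonneg[of P "cylinder i x"] by linarith
  then show ?thesis
  proof cases
    case 1
    then have "cylinder i x = space P"
      using x by (auto simp: cylinder_def)
    moreover have "(\<integral>\<sigma>. indicator (space P) \<sigma> * f \<sigma> \<partial>P) = (\<integral>\<sigma>. f \<sigma> \<partial>P)"
      by (intro Bochner_Integration.integral_cong) auto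
    ultimately show ?thesis
      using 1 by (simp add: integral_given_def prob_space)
  next
    case 2
    then have "cylinder i x \<in> null_sets P"
      by (auto simp: null_sets_def emeasure_eq_measure)
    then have "AE \<sigma> in P. indicator (cylinder i x) \<sigma> * f \<sigma> = 0"
      by (rule AE_mp[OF AE_not_in]) auto
    then show ?thesis
      using 2 by (simp add: integral_eq_zero_AE)
  next
    case 3
    let ?C = "cylinder i x" and ?G = "\<lambda>\<eta>. f (splice_seq i x \<eta>)"
    have G: "?G \<in> borel_measurable (seq_space {i+1..})"
      using borel_measurable_integrable[OF integrable_cylinder_splice[OF K_prob[OF 3(1) x]]]
      by (simp add: K_prob[OF 3(1) x] cong: measurable_cong_sets)
    have meas: "(\<lambda>\<sigma>. restrict \<sigma> {i+1..}) \<in> measurable P (seq_space {i+1..})"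
      using measurable_restrict_seq_space[of "{i+1..}" "{1..}"] sets_P
      by (simp cong: measurable_cong_sets)
    have "integral_given i x = (\<integral>\<eta>. ?G \<eta> \<partial>K i x)"
      using 3 by (simp add: integral_given_def)
    also have "\<dots> = (\<integral>\<sigma>. ?G (restrict \<sigma> {i+1..}) \<partial>uniform_measure P ?C)"
      unfolding K_eq_distr[OF 3(1) x 3(2)] using G meas
      by (intro integral_distr) auto
    also have "\<dots> = (\<integral>\<sigma>. ?G (restrict \<sigma> {i+1..}) \<partial>density P (\<lambda>\<sigma>. ennreal (indicator ?C \<sigma> / prob ?C)))"
      unfolding uniform_measure_def emeasure_eq_measure
      using 3(2) by (intro arg_cong2[of _ _ _ _ "integral\<^sup>L"] arg_cong2[of _ _ _ _ density] ext)
        (auto simp: divide_ennreal[symmetric] split: split_indicator)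
    also have "\<dots> = (\<integral>\<sigma>. (indicator ?C \<sigma> / prob ?C) *\<^sub>R ?G (restrict \<sigma> {i+1..}) \<partial>P)"
      using measurable_compose[OF meas G] 3(2) by (intro integral_density) auto
    also have "\<dots> = (\<integral>\<sigma>. (indicator ?C \<sigma> * f \<sigma>) / prob ?C \<partial>P)"
    proof (intro Bochner_Integration.integral_cong refl)
      fix \<sigma>
      \<comment> \<open>On the cylinder \<open>x\<close> is the prefix of \<open>\<sigma>\<close>
        itself, so splicing restores coordinates \<open>1\<close> to \<open>n\<close>.\<close>
      have "?G (restrict \<sigma> {i+1..}) = f \<sigma>" if "\<sigma> \<in> ?C"
        using that by (intro cylinder_fun_cong) (auto simp: cylinder_def splice_seq_def)
      then show "(indicator ?C \<sigma> / prob ?C) *\<^sub>R ?G (restrict \<sigma> {i+1..}) = (indicator ?C \<sigma> * f \<sigma>) / prob ?C"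
        by (auto split: split_indicator)
    qed
    finally show ?thesis
      using 3(2) by simp
  qed
qed

lemma integral_prefix_mult:
  fixes F \<phi> :: "(nat \<Rightarrow> 'a) \<Rightarrow> real"
  assumes \<phi>: "integrable P \<phi>"
  shows "(\<integral>\<sigma>. F (restrict \<sigma> {1..i}) * \<phi> \<sigma> \<partial>P)
    = (\<Sum>x\<in>{1..i} \<rightarrow>\<^sub>E UNIV. F x * (\<integral>\<sigma>. indicator (cylinder i x) \<sigma> * \<phi> \<sigma> \<partial>P))"
proof -
  let ?X = "{1..i} \<rightarrow>\<^sub>E (UNIV :: 'a set)"
  have fin: "finite ?X" by (rule finite_PiE_UNIV) simp
  have "(\<integral>\<sigma>. F (restrict \<sigma> {1..i}) * \<phi> \<sigma> \<partial>P)
      = (\<integral>\<sigma>. (\<Sum>x\<in>?X. F x * (indicator (cylinder i x) \<sigma> * \<phi> \<sigma>)) \<partial>P)"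
  proof (intro Bochner_Integration.integral_cong refl)
    fix \<sigma> assume "\<sigma> \<in> space P"
    then have "(\<Sum>x\<in>?X. F x * (indicator (cylinder i x) \<sigma> * \<phi> \<sigma>))
        = (\<Sum>x\<in>?X. if restrict \<sigma> {1..i} = x then F x * \<phi> \<sigma> else 0)"
      by (intro sum.cong) (auto simp: cylinder_def)
    then show "F (restrict \<sigma> {1..i}) * \<phi> \<sigma> = (\<Sum>x\<in>?X. F x * (indicator (cylinder i x) \<sigma> * \<phi> \<sigma>))"
      using fin by simp
  qed
  also have "\<dots> = (\<Sum>x\<in>?X. F x * (\<integral>\<sigma>. indicator (cylinder i x) \<sigma> * \<phi> \<sigma> \<partial>P))"
    using integrable_mult_indicator[OF cylinder_sets \<phi>]
    by (subst Bochner_Integration.integral_sum) auto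
  finally show ?thesis .
qed

lemma integrable_h: "integrable P (h i)"
  by (rule integrable_prefix) auto

text \<open>For \<open>k = i\<close> it suffices to compare the two integrals on each of the
  finitely many cylinders, where \<open>h i\<close> is constant and \<open>integral_cylinder\<close>
  applies.\<close>

lemma tower:
  fixes F :: "(nat \<Rightarrow> 'a) \<Rightarrow> real"
  assumes "k \<le> i"
  shows "(\<integral>\<sigma>. F (restrict \<sigma> {1..k}) * h i \<sigma> \<partial>P) = (\<integral>\<sigma>. F (restrict \<sigma> {1..k}) * f \<sigma> \<partial>P)"
proof -
  have "(\<integral>\<sigma>. F' (restrict \<sigma> {1..i}) * h i \<sigma> \<partial>P) = (\<integral>\<sigma>. F' (restrict \<sigma> {1..i}) * f \<sigma> \<partial>P)"
    for F' :: "(nat \<Rightarrow> 'a) \<Rightarrow> real"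
  proof (unfold integral_prefix_mult[OF integrable_h] integral_prefix_mult[OF integrable_f],
      intro sum.cong refl arg_cong2[of _ _ _ _ "(*)"])
    fix x assume x: "x \<in> {1..i} \<rightarrow>\<^sub>E (UNIV :: 'a set)"
    have "(\<integral>\<sigma>. indicator (cylinder i x) \<sigma> * h i \<sigma> \<partial>P)
        = (\<integral>\<sigma>. indicator (cylinder i x) \<sigma> * integral_given i x \<partial>P)"
      by (intro Bochner_Integration.integral_cong refl)
        (auto simp: cylinder_def split: split_indicator)
    then show "(\<integral>\<sigma>. indicator (cylinder i x) \<sigma> * h i \<sigma> \<partial>P) = (\<integral>\<sigma>. indicator (cylinder i x) \<sigma> * f \<sigma> \<partial>P)"
      unfolding integral_cylinder[OF x] by simp
  qed
  \<comment> \<open>A function of the first \<open>k \<le> i\<close> coordinates is also one of the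
    first \<open>i\<close>.\<close>
  from this[of "\<lambda>y. F (restrict y {1..k})"] show ?thesis
    using assms by (simp add: inf_absorb2)
qed

section \<open>Bounding the increments by the coupling matrix\<close>

text \<open>Row \<open>Suc k\<close> uses only the past before position \<open>Suc k\<close>; this
  makes its entries measurable, integrable and constant on cylinders of length
  \<open>k\<close>.\<close>

lemma coupling_matrix_prefix: "D \<sigma> (Suc k) j = D (restrict \<sigma> {1..k}) (Suc k) j"
  unfolding coupling_matrix_def
  by (simp add: atLeastLessThanSuc_atLeastAtMost restrict_restrict)

lemma coupling_matrix_ge:
  assumes "Suc k < j"
  shows "measure (Q (Suc k) (restrict \<sigma> {1..k}) a b)
      {\<omega> \<in> space (Q (Suc k) (restrict \<sigma> {1..k}) a b). fst \<omega> j \<noteq> snd \<omega> j} \<le> D \<sigma> (Suc k) j"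
proof -
  let ?m = "\<lambda>(a, b). let R = Q (Suc k) (restrict \<sigma> {1..<Suc k}) a b
      in measure R {\<omega> \<in> space R. fst \<omega> j \<noteq> snd \<omega> j}"
  have "?m (a, b) \<le> Max (range ?m)"
    by (rule Max_ge) auto
  then show ?thesis
    using assms by (simp add: coupling_matrix_def atLeastLessThanSuc_atLeastAtMost Let_def)
qed

lemma coupling_matrix_nonneg: "0 \<le> D \<sigma> i j"
proof -
  let ?m = "\<lambda>(a, b). let R = Q i (restrict \<sigma> {1..<i}) a b
      in measure R {\<omega> \<in> space R. fst \<omega> j \<noteq> snd \<omega> j}"
  have "?m (undefined, undefined) \<le> Max (range ?m)"
    by (rule Max_ge) auto
  then have "0 \<le> Max (range ?m)"
    by (rule order_trans[rotated]) (simp add: Let_def)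
  then show ?thesis
    unfolding coupling_matrix_def by simp
qed

text \<open>The \<open>i\<close>-th entry of the matrix \<open>D \<sigma>\<close> applied to
  \<open>\<delta>\<close>; the sum stops at \<open>n\<close> because the variation vanishes
  beyond.\<close>

definition row_bound :: "nat \<Rightarrow> (nat \<Rightarrow> 'a) \<Rightarrow> real" where
  "row_bound i \<sigma> = (\<Sum>j=1..n. \<delta> j * D \<sigma> i j)"

lemma row_bound_prefix: "row_bound (Suc k) \<sigma> = row_bound (Suc k) (restrict \<sigma> {1..k})"
  unfolding row_bound_def using coupling_matrix_prefix[of \<sigma>] by simp

text \<open>Both integrals are taken under the coupling \<open>Q\<close>, by its marginals. The
  spliced sequences agree before \<open>Suc k\<close>, may differ at \<open>Suc k\<close>, and
  differ at a later \<open>j\<close> with probability at most the matrix entry;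
  \<open>abs_diff_le_sum_variation\<close> weighs these disagreements.\<close>

lemma integral_given_diff_le:
  assumes x: "x \<in> {1..k} \<rightarrow>\<^sub>E UNIV"
  shows "\<bar>integral_given (Suc k) (x(Suc k := a)) - integral_given (Suc k) (x(Suc k := b))\<bar>
    \<le> row_bound (Suc k) x"
proof -
  let ?i = "Suc k"
  let ?xa = "x(?i := a)" and ?xb = "x(?i := b)"
  let ?R = "Q ?i x a b"
  have xa: "?xa \<in> {1..?i} \<rightarrow>\<^sub>E UNIV" and xb: "?xb \<in> {1..?i} \<rightarrow>\<^sub>E UNIV"
    using x by (auto simp: PiE_iff extensional_def)
  have "?i \<ge> 1" by simp
  note Ka = K_prob[OF this xa] and Kb = K_prob[OF this xb]
  have "x \<in> {1..<?i} \<rightarrow>\<^sub>E UNIV"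
    using x by (simp add: atLeastLessThanSuc_atLeastAtMost)
  then have coupling: "is_coupling (K ?i ?xa) (K ?i ?xb) ?R"
    using couplings unfolding maximal_couplings_def is_maximal_coupling_def by simp
  then have sets_R: "sets ?R = sets (K ?i ?xa \<Otimes>\<^sub>M K ?i ?xb)"
    and distr_a: "distr ?R (K ?i ?xa) fst = K ?i ?xa" and distr_b: "distr ?R (K ?i ?xb) snd = K ?i ?xb"
    unfolding is_coupling_def by auto
  interpret R: prob_space ?R
    using coupling unfolding is_coupling_def by auto
  have fst_meas: "fst \<in> measurable ?R (K ?i ?xa)" and snd_meas: "snd \<in> measurable ?R (K ?i ?xb)"
    using sets_R by (simp_all cong: measurable_cong_sets)
  let ?Ga = "\<lambda>\<eta>. f (splice_seq ?i ?xa \<eta>)" and ?Gb = "\<lambda>\<eta>. f (splice_seq ?i ?xb \<eta>)"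
  have Ga: "integrable (K ?i ?xa) ?Ga" and Gb: "integrable (K ?i ?xb) ?Gb"
    using Ka Kb by (auto intro!: integrable_cylinder_splice)
  have int_a: "integrable ?R (\<lambda>\<omega>. ?Ga (fst \<omega>))" "integral_given ?i ?xa = (\<integral>\<omega>. ?Ga (fst \<omega>) \<partial>?R)"
    using Ga integrable_distr[OF fst_meas, of ?Ga] integral_distr[OF fst_meas borel_measurable_integrable[OF Ga]]
    unfolding distr_a by (auto simp: integral_given_def)
  have int_b: "integrable ?R (\<lambda>\<omega>. ?Gb (snd \<omega>))" "integral_given ?i ?xb = (\<integral>\<omega>. ?Gb (snd \<omega>) \<partial>?R)"
    using Gb integrable_distr[OF snd_meas, of ?Gb] integral_distr[OF snd_meas borel_measurable_integrable[OF Gb]]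
    unfolding distr_b by (auto simp: integral_given_def)
  define N where "N j = {\<omega> \<in> space ?R. fst \<omega> j \<noteq> snd \<omega> j}" for j
  have N_sets: "N j \<in> sets ?R" if "?i < j" for j
  proof -
    have coord: "(\<lambda>\<eta>. \<eta> j) \<in> measurable (seq_space {?i+1..}) (count_space UNIV)"
      unfolding seq_space_def using that by (intro measurable_component_singleton) auto
    have "fst \<in> measurable ?R (seq_space {?i+1..})" "snd \<in> measurable ?R (seq_space {?i+1..})"
      using fst_meas snd_meas measurable_cong_sets[OF refl Ka(2)] measurable_cong_sets[OF refl Kb(2)]
      by blast+
    note 1 = measurable_compose[OF this(1) coord] and 2 = measurable_compose[OF this(2) coord]
    \<comment> \<open>Splitting by the letter \<open>c\<close> of the first component writes the
      event as a finite union of measurable sets, the alphabet being finite.\<close>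
    have "N j = (\<Union>c. ((\<lambda>\<omega>. fst \<omega> j) -` {c} \<inter> space ?R) \<inter> ((\<lambda>\<omega>. snd \<omega> j) -` (- {c}) \<inter> space ?R))"
      by (auto simp: N_def)
    also have "\<dots> \<in> sets ?R"
      using 1 2 by (intro sets.finite_UN sets.Int measurable_sets) auto
    finally show ?thesis .
  qed
  \<comment> \<open>Dominates the indicator of disagreement at \<open>j\<close>. Its three cases
    mirror those of \<open>coupling_matrix\<close>, with 1 on the diagonal even when
    \<open>a = b\<close>.\<close>
  define e :: "nat \<Rightarrow> (nat \<Rightarrow> 'a) \<times> (nat \<Rightarrow> 'a) \<Rightarrow> real"
    where "e j \<omega> = (if j = ?i then 1 else if ?i < j then indicator (N j) \<omega> else 0)" for j \<omega>
  have e_int: "integrable ?R (e j)" for j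
    unfolding e_def using N_sets[of j]
    by (cases j ?i rule: linorder_cases) (auto simp: R.emeasure_eq_measure)
  have e_le: "(\<integral>\<omega>. e j \<omega> \<partial>?R) \<le> D x ?i j" for j
  proof -
    consider "j = ?i" | "?i < j" | "j < ?i" by linarith
    then show ?thesis
    proof cases
      case 1
      then show ?thesis by (simp add: e_def coupling_matrix_def R.prob_space)
    next
      case 2
      have "restrict x {1..k} = x"
        using x by (simp add: PiE_restrict)
      then show ?thesis
        using 2 coupling_matrix_ge[of k j x a b] N_sets[OF 2] unfolding N_def by (simp add: e_def N_def)
    next
      case 3
      then show ?thesis by (simp add: e_def coupling_matrix_nonneg)
    qed
  qed
  have pointwise: "\<bar>?Ga (fst \<omega>) - ?Gb (snd \<omega>)\<bar> \<le> (\<Sum>j=1..n. \<delta> j * e j \<omega>)" if \<omega>: "\<omega> \<in> space ?R" for \<omega>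
  proof -
    have fs: "fst \<omega> \<in> {?i+1..} \<rightarrow>\<^sub>E UNIV" "snd \<omega> \<in> {?i+1..} \<rightarrow>\<^sub>E UNIV"
      using measurable_space[OF fst_meas \<omega>] measurable_space[OF snd_meas \<omega>]
        sets_eq_imp_space_eq[OF Ka(2)] sets_eq_imp_space_eq[OF Kb(2)] by (auto simp: space_seq_space)
    have "splice_seq ?i ?xa (fst \<omega>) \<in> {1..} \<rightarrow>\<^sub>E UNIV" "splice_seq ?i ?xb (snd \<omega>) \<in> {1..} \<rightarrow>\<^sub>E UNIV"
      using xa xb fs by (auto simp: PiE_iff extensional_def splice_seq_def)
    from abs_diff_le_sum_variation[OF this]
    have "\<bar>?Ga (fst \<omega>) - ?Gb (snd \<omega>)\<bar> \<le> (\<Sum>j=1..n. \<delta> j * of_bool (splice_seq ?i ?xa (fst \<omega>) j \<noteq> splice_seq ?i ?xb (snd \<omega>) j))" .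
    also have "\<dots> \<le> (\<Sum>j=1..n. \<delta> j * e j \<omega>)"
      using \<omega> by (intro sum_mono mult_left_mono variation_nonneg)
        (auto simp: e_def N_def splice_seq_def)
    finally show ?thesis .
  qed
  have "\<bar>integral_given ?i ?xa - integral_given ?i ?xb\<bar> = \<bar>\<integral>\<omega>. ?Ga (fst \<omega>) - ?Gb (snd \<omega>) \<partial>?R\<bar>"
    using int_a int_b by simp
  also have "\<dots> \<le> (\<integral>\<omega>. \<bar>?Ga (fst \<omega>) - ?Gb (snd \<omega>)\<bar> \<partial>?R)"
    by (rule integral_abs_bound)
  also have "\<dots> \<le> (\<integral>\<omega>. (\<Sum>j=1..n. \<delta> j * e j \<omega>) \<partial>?R)"
    using int_a(1) int_b(1) e_int by (intro integral_mono pointwise) auto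
  also have "\<dots> = (\<Sum>j=1..n. \<delta> j * (\<integral>\<omega>. e j \<omega> \<partial>?R))"
    using e_int by (subst Bochner_Integration.integral_sum) auto
  also have "\<dots> \<le> row_bound ?i x"
    unfolding row_bound_def by (intro sum_mono mult_left_mono e_le variation_nonneg)
  finally show ?thesis .
qed

text \<open>\<open>h k \<sigma>\<close> is the average of \<open>h (Suc k)\<close> over the cylinder
  of \<open>\<sigma>\<close>. Each averaged value is within
  \<open>row_bound (Suc k) \<sigma>\<close> of \<open>h (Suc k) \<sigma>\<close>, hence so is the
  average; positivity permits division by the mass.\<close>

lemma increment_le_on_positive_cylinder:
  assumes \<sigma>: "\<sigma> \<in> space P" and pos: "prob (cylinder k (restrict \<sigma> {1..k})) > 0"
  shows "\<bar>h (Suc k) \<sigma> - h k \<sigma>\<bar> \<le> row_bound (Suc k) \<sigma>"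
proof -
  let ?x = "restrict \<sigma> {1..k}"
  let ?C = "cylinder k ?x"
  have ind: "indicator ?C \<tau> = of_bool (restrict \<tau> {1..k} = ?x)" if "\<tau> \<in> space P" for \<tau>
    using that by (simp add: cylinder_def)
  have same: "(\<integral>\<tau>. indicator ?C \<tau> * h i \<tau> \<partial>P) = (\<integral>\<tau>. indicator ?C \<tau> * f \<tau> \<partial>P)" if "k \<le> i" for i
  proof -
    have "(\<integral>\<tau>. indicator ?C \<tau> * \<phi> \<tau> \<partial>P) = (\<integral>\<tau>. of_bool (restrict \<tau> {1..k} = ?x) * \<phi> \<tau> \<partial>P)"
      for \<phi> :: "(nat \<Rightarrow> 'a) \<Rightarrow> real"
      by (intro Bochner_Integration.integral_cong refl) (simp only: ind)
    with tower[OF that, of "\<lambda>y. of_bool (y = ?x)"] show ?thesis by simp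
  qed
  have ind_int: "integrable P (\<lambda>\<tau>. indicator ?C \<tau> * h i \<tau>)" for i
    using integrable_mult_indicator[OF cylinder_sets integrable_h] by simp
  have const_int: "integrable P (\<lambda>\<tau>. indicator ?C \<tau> * c)" for c :: real
    by (auto simp: emeasure_eq_measure)
  have close: "\<bar>h (Suc k) \<sigma> - h (Suc k) \<tau>\<bar> \<le> row_bound (Suc k) \<sigma>" if "\<tau> \<in> ?C" for \<tau>
  proof -
    have \<tau>: "restrict \<tau> {1..k} = ?x"
      using that by (simp add: cylinder_def)
    \<comment> \<open>Within the cylinder the prefixes of length \<open>Suc k\<close> differ at most
      in their last letter, the situation of \<open>integral_given_diff_le\<close>.\<close>
    have extend: "restrict \<rho> {1..Suc k} = (restrict \<rho> {1..k})(Suc k := \<rho> (Suc k))" for \<rho> :: "nat \<Rightarrow> 'a"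
      by (auto simp: fun_eq_iff)
    have "?x \<in> {1..k} \<rightarrow>\<^sub>E UNIV" by simp
    from integral_given_diff_le[OF this, of "\<sigma> (Suc k)" "\<tau> (Suc k)"] show ?thesis
      unfolding extend \<tau> row_bound_prefix[of k \<sigma>] .
  qed
  have "prob ?C * h k \<sigma> = (\<integral>\<tau>. indicator ?C \<tau> * h k \<sigma> \<partial>P)"
    by simp
  also have "\<dots> = (\<integral>\<tau>. indicator ?C \<tau> * h k \<tau> \<partial>P)"
    by (intro Bochner_Integration.integral_cong refl) (auto simp: cylinder_def split: split_indicator)
  also have "\<dots> = (\<integral>\<tau>. indicator ?C \<tau> * h (Suc k) \<tau> \<partial>P)"
    using same[of k] same[of "Suc k"] by simp
  finally have "prob ?C * (h (Suc k) \<sigma> - h k \<sigma>)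
      = (\<integral>\<tau>. indicator ?C \<tau> * h (Suc k) \<sigma> \<partial>P) - (\<integral>\<tau>. indicator ?C \<tau> * h (Suc k) \<tau> \<partial>P)"
    by (simp add: right_diff_distrib)
  also have "\<dots> = (\<integral>\<tau>. indicator ?C \<tau> * h (Suc k) \<sigma> - indicator ?C \<tau> * h (Suc k) \<tau> \<partial>P)"
    by (intro Bochner_Integration.integral_diff[symmetric] ind_int const_int)
  finally have eq: "prob ?C * (h (Suc k) \<sigma> - h k \<sigma>)
      = (\<integral>\<tau>. indicator ?C \<tau> * h (Suc k) \<sigma> - indicator ?C \<tau> * h (Suc k) \<tau> \<partial>P)" .
  have "\<bar>prob ?C * (h (Suc k) \<sigma> - h k \<sigma>)\<bar>
      \<le> (\<integral>\<tau>. \<bar>indicator ?C \<tau> * h (Suc k) \<sigma> - indicator ?C \<tau> * h (Suc k) \<tau>\<bar> \<partial>P)"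
    unfolding eq by (rule integral_abs_bound)
  also have "\<dots> \<le> (\<integral>\<tau>. indicator ?C \<tau> * row_bound (Suc k) \<sigma> \<partial>P)"
  proof (intro integral_mono const_int integrable_abs Bochner_Integration.integrable_diff ind_int)
    fix \<tau>
    show "\<bar>indicator ?C \<tau> * h (Suc k) \<sigma> - indicator ?C \<tau> * h (Suc k) \<tau>\<bar> \<le> indicator ?C \<tau> * row_bound (Suc k) \<sigma>"
      using close[of \<tau>] by (cases "\<tau> \<in> ?C") auto
  qed
  also have "\<dots> = prob ?C * row_bound (Suc k) \<sigma>" by simp
  finally show ?thesis
    using pos by (simp add: abs_mult)
qed

text \<open>There are only finitely many cylinders of length \<open>k\<close>, so the null ones can
  be discarded together.\<close>

lemma AE_increment_le: "AE \<sigma> in P. \<bar>h (Suc k) \<sigma> - h k \<sigma>\<bar> \<le> row_bound (Suc k) \<sigma>"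
proof -
  have "AE \<sigma> in P. \<forall>x\<in>{1..k} \<rightarrow>\<^sub>E UNIV. prob (cylinder k x) = 0 \<longrightarrow> \<sigma> \<notin> cylinder k x"
  proof (intro AE_finite_allI finite_PiE_UNIV)
    show "AE \<sigma> in P. prob (cylinder k x) = 0 \<longrightarrow> \<sigma> \<notin> cylinder k x" for x
      using AE_not_in[of "cylinder k x" P]
      by (cases "prob (cylinder k x) = 0") (auto simp: null_sets_def emeasure_eq_measure)
  qed simp
  with AE_space show ?thesis
  proof eventually_elim
    case (elim \<sigma>)
    then have "prob (cylinder k (restrict \<sigma> {1..k})) \<noteq> 0"
      by (auto simp: cylinder_def)
    then have "prob (cylinder k (restrict \<sigma> {1..k})) > 0"
      using measure_nonneg[of P "cylinder k (restrict \<sigma> {1..k})"] by linarith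
    with elim show ?case by (intro increment_le_on_positive_cylinder) auto
  qed
qed

section \<open>Moments of the increments\<close>

abbreviation "MM q \<equiv> moment_matrix P D q"

lemma moment_matrix_nonneg: "0 \<le> MM q i j"
  by (simp add: moment_matrix_def)

lemma moment_matrix_power:
  assumes "q \<ge> 1"
  shows "MM q i j ^ q = (\<integral>\<sigma>. D \<sigma> i j ^ q \<partial>P)"
proof -
  have "0 \<le> (\<integral>\<sigma>. D \<sigma> i j ^ q \<partial>P)"
    by (intro integral_nonneg_AE AE_I2 zero_le_power coupling_matrix_nonneg)
  then show ?thesis
    using assms unfolding moment_matrix_def
    by (subst powr_realpow'[symmetric]) (auto simp: powr_powr)
qed

text \<open>Minkowski's inequality in \<open>L^q\<close> replaces each random entry by its
  \<open>L^q\<close> norm, which is the entry of the moment matrix.\<close>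

lemma row_bound_moment:
  assumes q: "q \<ge> 1"
  shows "integrable P (\<lambda>\<sigma>. row_bound (Suc k) \<sigma> ^ q)"
    "(\<integral>\<sigma>. row_bound (Suc k) \<sigma> ^ q \<partial>P) \<le> (\<Sum>j=1..n. \<delta> j * MM q (Suc k) j) ^ q"
proof -
  let ?u = "\<lambda>j \<sigma>. \<delta> j * D \<sigma> (Suc k) j"
  have prefix: "{1..k} \<subseteq> {1..}" "finite {1..k}" by auto
  have meas: "?u j \<in> borel_measurable P" for j
    by (subst coupling_matrix_prefix) (rule measurable_prefix[OF prefix])
  have int: "integrable P (\<lambda>\<sigma>. ?u j \<sigma> ^ q)" for j
    by (subst coupling_matrix_prefix) (rule integrable_prefix[OF prefix])
  have le: "(\<integral>\<sigma>. ?u j \<sigma> ^ q \<partial>P) \<le> (\<delta> j * MM q (Suc k) j) ^ q" for j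
    by (simp add: power_mult_distrib moment_matrix_power[OF q])
  show "integrable P (\<lambda>\<sigma>. row_bound (Suc k) \<sigma> ^ q)"
    "(\<integral>\<sigma>. row_bound (Suc k) \<sigma> ^ q \<partial>P) \<le> (\<Sum>j=1..n. \<delta> j * MM q (Suc k) j) ^ q"
    unfolding row_bound_def
    by (rule Minkowski_power_sum[OF _ q meas _ int le];
      simp add: variation_nonneg coupling_matrix_nonneg moment_matrix_nonneg)+
qed

lemma increment_moment:
  assumes "p \<ge> 1"
  shows "(\<integral>\<sigma>. (h (Suc k) \<sigma> - h k \<sigma>) ^ (2 * p) \<partial>P)
    \<le> (\<Sum>j=1..n. \<delta> j * MM (2 * p) (Suc k) j) ^ (2 * p)"
proof -
  have q: "2 * p \<ge> 1" using assms by simp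
  \<comment> \<open>The increment is written as a function of the prefix of length
    \<open>Suc k\<close>, for which integrability is automatic.\<close>
  have "integrable P (\<lambda>\<sigma>. (\<lambda>y. (integral_given (Suc k) y - integral_given k (restrict y {1..k})) ^ (2 * p))
      (restrict \<sigma> {1..Suc k}))"
    by (rule integrable_prefix) auto
  then have int: "integrable P (\<lambda>\<sigma>. (h (Suc k) \<sigma> - h k \<sigma>) ^ (2 * p))"
    by (simp add: inf_absorb2)
  have "(\<integral>\<sigma>. (h (Suc k) \<sigma> - h k \<sigma>) ^ (2 * p) \<partial>P) \<le> (\<integral>\<sigma>. row_bound (Suc k) \<sigma> ^ (2 * p) \<partial>P)"
  proof (rule integral_mono_AE[OF int row_bound_moment(1)[OF q]])
    show "AE \<sigma> in P. (h (Suc k) \<sigma> - h k \<sigma>) ^ (2 * p) \<le> row_bound (Suc k) \<sigma> ^ (2 * p)"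
      using AE_increment_le[of k]
    proof eventually_elim
      case (elim \<sigma>)
      then show ?case
        using power_mono[OF elim, of "2 * p"] by (simp add: power_even_abs)
    qed
  qed
  also note row_bound_moment(2)[OF q]
  finally show ?thesis .
qed

lemma h_0: "h 0 \<sigma> = (\<integral>\<tau>. f \<tau> \<partial>P)"
  by (simp add: integral_given_def)

text \<open>Once all \<open>n\<close> relevant coordinates are fixed, the integrand is constant and
  \<open>K n\<close> has total mass 1.\<close>

lemma h_n:
  assumes "n \<ge> 1"
  shows "h n \<sigma> = f \<sigma>"
proof -
  have "restrict \<sigma> {1..n} \<in> {1..n} \<rightarrow>\<^sub>E UNIV" by simp
  then interpret Kn: prob_space "K n (restrict \<sigma> {1..n})"
    using K_prob(1) assms by blast
  have "f (splice_seq n (restrict \<sigma> {1..n}) \<eta>) = f \<sigma>" for \<eta>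
    by (rule cylinder_fun_cong) (auto simp: splice_seq_def)
  then show ?thesis
    using assms Kn.prob_space by (simp add: integral_given_def)
qed

text \<open>The martingale bound is applied to \<open>h k - h 0\<close>, which starts at 0 and
  reaches \<open>f\<close> minus its mean after \<open>n\<close> steps. The weight of step
  \<open>k\<close> is entry \<open>Suc k\<close> of the moment matrix applied to
  \<open>\<delta>\<close>.\<close>

lemma centered_moment_le:
  assumes n: "n \<ge> 1" and p: "p \<ge> 1"
  shows "(\<integral>\<sigma>. (f \<sigma> - (\<integral>\<tau>. f \<tau> \<partial>P)) ^ (2 * p) \<partial>P)
    \<le> (4 * real p * (\<Sum>i=1..n. (\<Sum>j=1..n. \<delta> j * MM (2 * p) i j)\<^sup>2)) ^ p"
proof -
  let ?S = "\<lambda>k \<sigma>. h k \<sigma> - h 0 \<sigma>"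
  have "\<exists>B. \<forall>\<sigma>. \<bar>?S k \<sigma>\<bar> \<le> B" for k
  proof -
    obtain B where "\<And>\<sigma>. \<bar>(\<lambda>y. integral_given k y - (\<integral>\<tau>. f \<tau> \<partial>P)) (restrict \<sigma> {1..k})\<bar> \<le> B"
      using bounded_fun_restrict[of "{1..k}" "\<lambda>y. integral_given k y - (\<integral>\<tau>. f \<tau> \<partial>P)"] by blast
    then show ?thesis
      unfolding h_0 by blast
  qed
  then obtain B where B: "\<And>k \<sigma>. \<bar>?S k \<sigma>\<bar> \<le> B k"
    by metis
  have "(\<integral>\<sigma>. ?S n \<sigma> ^ (2 * p) \<partial>P)
      \<le> (4 * real p * (\<Sum>k<n. (\<Sum>j=1..n. \<delta> j * MM (2 * p) (Suc k) j)\<^sup>2)) ^ p"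
  proof (rule martingale_moment_le[where S = ?S and N = n and B = B
        and W = "\<lambda>k. \<Sum>j=1..n. \<delta> j * MM (2 * p) (Suc k) j", OF p])
    show "?S k \<in> borel_measurable P" for k
      by (intro borel_measurable_diff borel_measurable_integrable integrable_h)
    show "\<bar>?S k \<sigma>\<bar> \<le> B k" for k \<sigma> by (rule B)
    show "?S 0 \<sigma> = 0" for \<sigma> by simp
    show "(\<integral>\<sigma>. (?S (Suc k) \<sigma> - ?S k \<sigma>) ^ (2 * p) \<partial>P)
        \<le> (\<Sum>j=1..n. \<delta> j * MM (2 * p) (Suc k) j) ^ (2 * p)" for k
      using increment_moment[OF p, of k] by simp
    show "(\<integral>\<sigma>. ?S k \<sigma> ^ (2 * p - 1) * (?S (Suc k) \<sigma> - ?S k \<sigma>) \<partial>P) = 0" for k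
    proof -
      \<comment> \<open>The power of the partial sum depends on the first \<open>k\<close>
        coordinates only, so \<open>tower\<close> turns its integrals against \<open>h k\<close> and
        \<open>h (Suc k)\<close> into the same integral against \<open>f\<close>.\<close>
      define F where "F y = (integral_given k y - (\<integral>\<tau>. f \<tau> \<partial>P)) ^ (2 * p - 1)" for y
      have prefix: "{1..Suc k} \<subseteq> {1..}" "finite {1..Suc k}" by auto
      have "integrable P (\<lambda>\<sigma>. (\<lambda>y. F (restrict y {1..k}) * integral_given k (restrict y {1..k})) (restrict \<sigma> {1..Suc k}))"
        "integrable P (\<lambda>\<sigma>. (\<lambda>y. F (restrict y {1..k}) * integral_given (Suc k) y) (restrict \<sigma> {1..Suc k}))"
        by (rule integrable_prefix[OF prefix])+
      then have int: "integrable P (\<lambda>\<sigma>. F (restrict \<sigma> {1..k}) * h k \<sigma>)"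
        "integrable P (\<lambda>\<sigma>. F (restrict \<sigma> {1..k}) * h (Suc k) \<sigma>)"
        by (simp_all add: inf_absorb2)
      have "(\<integral>\<sigma>. ?S k \<sigma> ^ (2 * p - 1) * (?S (Suc k) \<sigma> - ?S k \<sigma>) \<partial>P)
          = (\<integral>\<sigma>. F (restrict \<sigma> {1..k}) * h (Suc k) \<sigma> - F (restrict \<sigma> {1..k}) * h k \<sigma> \<partial>P)"
        unfolding F_def h_0 by (simp add: right_diff_distrib)
      also have "\<dots> = (\<integral>\<sigma>. F (restrict \<sigma> {1..k}) * h (Suc k) \<sigma> \<partial>P) - (\<integral>\<sigma>. F (restrict \<sigma> {1..k}) * h k \<sigma> \<partial>P)"
        by (intro Bochner_Integration.integral_diff int)
      also have "\<dots> = 0"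
        using tower[of k k F] tower[of k "Suc k" F] by simp
      finally show ?thesis .
    qed
  qed
  then show ?thesis
    unfolding h_0 h_n[OF n]
    by (simp add: sum.atLeast1_atMost_eq lessThan_atLeast0)
qed

section \<open>Passage to the operator norm\<close>

lemma l2_variation:
  "in_l2 \<delta>" "l2_norm \<delta> = sqrt (\<Sum>j=1..n. (\<delta> j)\<^sup>2)"
proof -
  have zero: "(\<delta> j)\<^sup>2 = 0" if "j \<in> {1..} - {1..n}" for j
    using that variation_eq_0[of n j g] by auto
  have "(\<lambda>j. (\<delta> j)\<^sup>2) summable_on {1..n}" by (rule summable_on_finite) simp
  then show "in_l2 \<delta>"
    unfolding in_l2_def using zero
    by (subst summable_on_cong_neutral[where T = "{1..n}" and g = "\<lambda>j. (\<delta> j)\<^sup>2"]) auto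
  have "(\<Sum>\<^sub>\<infinity>j\<in>{1..}. (\<delta> j)\<^sup>2) = (\<Sum>\<^sub>\<infinity>j\<in>{1..n}. (\<delta> j)\<^sup>2)"
    using zero by (intro infsum_cong_neutral) auto
  then show "l2_norm \<delta> = sqrt (\<Sum>j=1..n. (\<delta> j)\<^sup>2)"
    unfolding l2_norm_def by simp
qed

lemma mat_vec_variation: "mat_vec M \<delta> i = (\<Sum>j=1..n. \<delta> j * M i j)"
proof -
  have "(\<Sum>\<^sub>\<infinity>j\<in>{1..}. M i j * \<delta> j) = (\<Sum>\<^sub>\<infinity>j\<in>{1..n}. M i j * \<delta> j)"
    using variation_eq_0[of n _ g] by (intro infsum_cong_neutral) auto
  then show ?thesis
    unfolding mat_vec_def by (simp add: mult.commute)
qed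

text \<open>Treats a single admissible constant \<open>C\<close>, leaving the infimum for later. The
  first \<open>n\<close> squared entries of the image vector sum to at most its full squared
  norm.\<close>

lemma centered_moment_le_bound:
  assumes n: "n \<ge> 1" and p: "p \<ge> 1" and C: "0 \<le> C"
    and bound: "in_l2 (mat_vec (MM (2 * p)) \<delta>)"
      "l2_norm (mat_vec (MM (2 * p)) \<delta>) \<le> C * l2_norm \<delta>"
  shows "(\<integral>\<sigma>. (f \<sigma> - (\<integral>\<tau>. f \<tau> \<partial>P)) ^ (2 * p) \<partial>P) \<le> (20 * real p * C * l2_norm \<delta>) ^ (2 * p)"
proof -
  let ?W = "mat_vec (MM (2 * p)) \<delta>"
  have nn: "0 \<le> l2_norm ?W" unfolding l2_norm_def by (simp add: infsum_nonneg)
  have "(\<Sum>i=1..n. (?W i)\<^sup>2) \<le> (l2_norm ?W)\<^sup>2"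
    by (rule sum_le_l2_norm_power2[OF bound(1)])
  also have "\<dots> \<le> (C * l2_norm \<delta>)\<^sup>2"
    using bound(2) nn by (rule power_mono)
  finally have W: "(\<Sum>i=1..n. (?W i)\<^sup>2) \<le> (C * l2_norm \<delta>)\<^sup>2" .
  have "4 * real p \<le> (20 * real p)\<^sup>2"
  proof -
    have "1 * real p \<le> real p * real p"
      using p by (intro mult_right_mono) auto
    then show ?thesis by (simp add: power2_eq_square)
  qed
  then have "4 * real p * (\<Sum>i=1..n. (?W i)\<^sup>2) \<le> (20 * real p)\<^sup>2 * (C * l2_norm \<delta>)\<^sup>2"
    by (intro mult_mono W) (auto intro: sum_nonneg)
  then have "(4 * real p * (\<Sum>i=1..n. (?W i)\<^sup>2)) ^ p \<le> ((20 * real p)\<^sup>2 * (C * l2_norm \<delta>)\<^sup>2) ^ p"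
    by (intro power_mono mult_nonneg_nonneg sum_nonneg) auto
  also have "\<dots> = (20 * real p * C * l2_norm \<delta>) ^ (2 * p)"
    by (simp only: power_mult power_mult_distrib mult.assoc)
  finally show ?thesis
    using centered_moment_le[OF n p] unfolding mat_vec_variation by linarith
qed

text \<open>Covers the convention \<open>\<infinity> * 0 = 0\<close>: when the variation vanishes,
  an infinite operator norm still leaves 0 on the right, so the moment itself must vanish.\<close>

lemma centered_moment_le_0:
  assumes n: "n \<ge> 1" and p: "p \<ge> 1" and v: "l2_norm \<delta> = 0"
  shows "(\<integral>\<sigma>. (f \<sigma> - (\<integral>\<tau>. f \<tau> \<partial>P)) ^ (2 * p) \<partial>P) \<le> 0"
proof -
  have "(\<Sum>j=1..n. (\<delta> j)\<^sup>2) = 0"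
    using v by (simp add: l2_variation(2))
  then have "\<delta> j = 0" if "j \<in> {1..n}" for j
    using that by (simp add: sum_nonneg_eq_0_iff)
  then have "(\<Sum>i=1..n. (\<Sum>j=1..n. \<delta> j * MM (2 * p) i j)\<^sup>2) = 0"
    by simp
  with centered_moment_le[OF n p] show ?thesis
    using p by (simp add: power_0_left)
qed

end

text \<open>Solving \<open>(a * c) ^ q = E\<close> for \<open>c\<close> gives a lower bound of all
  admissible \<open>C\<close>, hence of the infimum. This needs no attained infimum and includes the
  empty set, where \<open>Inf\<close> is infinite.\<close>

lemma ennreal_power_le_power_Inf:
  fixes E a :: real
  assumes q: "q \<ge> 1" and a: "0 < a" and E: "0 \<le> E"
    and le: "\<And>C. 0 \<le> C \<Longrightarrow> \<Phi> C \<Longrightarrow> E \<le> (a * C) ^ q"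
  shows "ennreal E \<le> (ennreal a * Inf {ennreal C | C. 0 \<le> C \<and> \<Phi> C}) ^ q"
proof -
  define c where "c = root q E / a"
  have c: "0 \<le> c" "(a * c) ^ q = E"
    using q a E by (auto simp: c_def real_root_pow_pos2)
  have "ennreal c \<le> Inf {ennreal C | C. 0 \<le> C \<and> \<Phi> C}"
  proof (rule Inf_greatest, clarify)
    fix C :: real assume C: "0 \<le> C" "\<Phi> C"
    have "(a * c) ^ q \<le> (a * C) ^ q"
      using le[OF C] c by simp
    then have "a * c \<le> a * C"
      using q a C by (subst (asm) power_mono_iff) (auto simp: c)
    then show "ennreal c \<le> ennreal C"
      using a by (intro ennreal_leI) simp
  qed
  then have "(ennreal a * ennreal c) ^ q \<le> (ennreal a * Inf {ennreal C | C. 0 \<le> C \<and> \<Phi> C}) ^ q"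
    by (intro power_mono mult_left_mono) auto
  moreover have "(ennreal a * ennreal c) ^ q = ennreal E"
    using a c by (simp add: ennreal_mult[symmetric] ennreal_power)
  ultimately show ?thesis by simp
qed

theorem theorem3:
  fixes P :: "(nat \<Rightarrow> 'a::finite) measure"
    and K :: "nat \<Rightarrow> (nat \<Rightarrow> 'a) \<Rightarrow> (nat \<Rightarrow> 'a) measure"
    and Q :: "nat \<Rightarrow> (nat \<Rightarrow> 'a) \<Rightarrow> 'a \<Rightarrow> 'a \<Rightarrow> ((nat \<Rightarrow> 'a) \<times> (nat \<Rightarrow> 'a)) measure"
    and g :: "(nat \<Rightarrow> 'a) \<Rightarrow> real"
    and n p :: nat
  assumes "prob_space P" and "sets P = sets (seq_space {1..})"
    and "conditional_versions P K"
    and "maximal_couplings K Q"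
    and "n \<ge> 1" and "p \<ge> 1"
  shows "ennreal (\<integral>\<sigma>. (cylinder_fun n g \<sigma> - (\<integral>\<tau>. cylinder_fun n g \<tau> \<partial>P)) ^ (2 * p) \<partial>P)
    \<le> ennreal ((20 * real p) ^ (2 * p))
        * l2_op_norm (moment_matrix P (coupling_matrix Q) (2 * p)) ^ (2 * p)
        * ennreal (l2_norm (variation (cylinder_fun n g))) ^ (2 * p)"
proof -
  interpret coupled_cylinder P K Q g n
    using assms(1-4) by (simp add: coupled_cylinder_def coupled_cylinder_axioms_def)
  note n = \<open>n \<ge> 1\<close> and p = \<open>p \<ge> 1\<close>
  let ?E = "\<integral>\<sigma>. (f \<sigma> - (\<integral>\<tau>. f \<tau> \<partial>P)) ^ (2 * p) \<partial>P" and ?v = "l2_norm \<delta>"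
  have v: "0 \<le> ?v" by (simp add: l2_variation(2) sum_nonneg)
  show ?thesis
  proof (cases "?v = 0")
    case True
    then show ?thesis
      using centered_moment_le_0[OF n p] by (simp add: ennreal_neg)
  next
    case False
    \<comment> \<open>The positive variation norm is merged into the factor \<open>?a\<close>, so
      that the bound for each \<open>C\<close> has the form
      \<open>(?a * C) ^ (2 * p)\<close>.\<close>
    let ?a = "20 * real p * ?v"
    have "ennreal ?E \<le> (ennreal ?a * l2_op_norm (MM (2 * p))) ^ (2 * p)"
      unfolding l2_op_norm_def
    proof (rule ennreal_power_le_power_Inf)
      show "0 < ?a" using False v p by simp
      show "0 \<le> ?E" by (intro integral_nonneg_AE AE_I2) simp
      fix C assume "0 \<le> C" and C: "\<forall>x. in_l2 x \<longrightarrow>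
        (\<forall>i\<ge>1. (\<lambda>j. MM (2 * p) i j * x j) summable_on {1..}) \<and>
        in_l2 (mat_vec (MM (2 * p)) x) \<and> l2_norm (mat_vec (MM (2 * p)) x) \<le> C * l2_norm x"
      then show "?E \<le> (?a * C) ^ (2 * p)"
        using centered_moment_le_bound[OF n p \<open>0 \<le> C\<close>] l2_variation(1) by (simp add: mult_ac)
    qed (use p in simp)
    also have "ennreal ?a = ennreal (20 * real p) * ennreal ?v"
      using v by (intro ennreal_mult) auto
    also have "(ennreal (20 * real p) * ennreal ?v * l2_op_norm (MM (2 * p))) ^ (2 * p)
        = ennreal ((20 * real p) ^ (2 * p)) * l2_op_norm (MM (2 * p)) ^ (2 * p) * ennreal ?v ^ (2 * p)"
      by (subst ennreal_power[symmetric]) (simp, simp only: power_mult_distrib mult_ac)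
    finally show ?thesis .
  qed
qed

end
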